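(* For $n\ge1$ let $\sigma_n(t)=H_n(t)+c_1t+c_2$ with $c_1=-n(n+\alpha+\beta+\gamma)-\frac{(\alpha+\beta)^2}{4}$ and $c_2=\frac14\left[2n(n+\alpha+\beta+\gamma)+(\alpha+\beta)\beta-(\alpha-\beta)\gamma\right]$. Then for $t\in(0,1)$, $\sigma_n$ satisfies the Jimbo–Miwa–Okamoto $\sigma$-form of Painlevé VI $$\sigma_n'\big[t(t-1)\sigma_n''\big]^2+\big[2\sigma_n'(t\sigma_n'-\sigma_n)-(\sigma_n')^2-\nu_1\nu_2\nu_3\nu_4\big]^2=\prod_{k=1}^4(\sigma_n'+\nu_k^2),$$ with $\nu_1=\frac{\alpha+\beta}{2}$, $\nu_2=\frac{\beta-\alpha}{2}$, $\nu_3=\frac{2n+\alpha+\beta}{2}$, $\nu_4=\frac{2n+\alpha+\beta+2\gamma}{2}$.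
   Context: Fix $\alpha,\beta,\gamma>0$ and real constants $A,B$ with $A\ge0$, $A+B\ge0$, not both $A$ and $A+B$ equal to $0$. Let $\theta$ be the Heaviside function ($\theta(x)=1$ for $x>0$, $0$ otherwise). For $t\in(0,1)$ put $w(x,t)=x^{\alpha}(1-x)^{\beta}|x-t|^{\gamma}(A+B\theta(x-t))$ on $[0,1]$, let $D_n(t)=\det\left(\int_0^1x^{i+j}w(x,t)dx\right)_{i,j=0}^{n-1}$, and $H_n(t)=t(t-1)\frac{d}{dt}\ln D_n(t)$. *)

theory Defs
  imports "HOL-Analysis.Analysis"
begin

definition heaviside :: "real \<Rightarrow> real" where
  "heaviside x = (if x > 0 then 1 else 0)"

definition wt :: "real \<Rightarrow> real \<Rightarrow> real \<Rightarrow> real \<Rightarrow> real \<Rightarrow> real \<Rightarrow> real \<Rightarrow> real" where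
  "wt \<alpha> \<beta> \<gamma> A B x t =
     x powr \<alpha> * (1 - x) powr \<beta> * \<bar>x - t\<bar> powr \<gamma> * (A + B * heaviside (x - t))"

definition moment :: "real \<Rightarrow> real \<Rightarrow> real \<Rightarrow> real \<Rightarrow> real \<Rightarrow> nat \<Rightarrow> real \<Rightarrow> real" where
  "moment \<alpha> \<beta> \<gamma> A B k t = integral {0..1} (\<lambda>x. x ^ k * wt \<alpha> \<beta> \<gamma> A B x t)"

definition hankel_det :: "real \<Rightarrow> real \<Rightarrow> real \<Rightarrow> real \<Rightarrow> real \<Rightarrow> nat \<Rightarrow> real \<Rightarrow> real" where
  "hankel_det \<alpha> \<beta> \<gamma> A B n t =
     (\<Sum>p | p permutes {..<n}. of_int (sign p) *
        (\<Prod>i<n. moment \<alpha> \<beta> \<gamma> A B (i + p i) t))"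

definition Hn :: "real \<Rightarrow> real \<Rightarrow> real \<Rightarrow> real \<Rightarrow> real \<Rightarrow> nat \<Rightarrow> real \<Rightarrow> real" where
  "Hn \<alpha> \<beta> \<gamma> A B n t =
     t * (t - 1) * deriv (\<lambda>s. ln (hankel_det \<alpha> \<beta> \<gamma> A B n s)) t"

end

(*
Write L p for the integral of the polynomial p against the weight at parameter t, and M_a p for that
of p/(x - a), a = 0, 1, t; all of these converge as \<alpha>, \<beta>, \<gamma> > 0.  Integration by parts gives
L p' + \<alpha> M_0 p + \<beta> M_1 p + \<gamma> M_t p = 0, and the t-derivatives of L, M_0, M_1 are again combinations of
these functionals.  With P_n the monic orthogonal polynomials, h_n = L(P_n^2), n = m + 1 and
(\<theta>_0, \<theta>_1, \<theta>_t) = (\<alpha>, \<beta>, \<gamma>), put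
  V_a = \<theta>_a M_a(P_n P_m) / h_m,   U_a = \<theta>_a M_a(P_n^2),   W_a = \<theta>_a M_a(P_m^2) / h_m^2.
These are the entries of the residue matrices of the Lax pair.  They satisfy U_a W_a = V_a (V_a - \<theta>_a),
\<Sum> U_a = \<Sum> W_a = 0 and \<Sum> V_a = -n, and V_1 + t V_t = p, the coefficient of x^m in P_n.  The Schlesinger
equations V_a' = (U_t W_a - U_a W_t)/(t - a) for a = 0, 1 give p' = V_t and
t (t - 1) V_t' = U_0 W_1 - U_1 W_0, whose square is a polynomial in the V_a.  As D_n is the product of
the h_k with k < n, H_n is an affine function of p, and so \<sigma>_n, \<sigma>_n' and (t (t - 1) \<sigma>_n'')^2 are
polynomials in t, p, V_t; the \<sigma>-form is then a polynomial identity.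
*)
theory Submission
  imports Defs "HOL-Computational_Algebra.Polynomial" "Jordan_Normal_Form.Determinant"
begin

text \<open>Two obstacles shape the development. The singularity of the weight at x = t moves with
  the parameter, and differentiation produces |x - t|^(\<gamma> - 1), so the derivative cannot
  simply be taken under the integral; the interval is cut at t and rescaled until t has left the
  singular factors. Moreover M_0 and M_1 have to be differentiated as well. They are L itself with
  \<alpha> or \<beta> lowered by one, up to a sign for M_1, which is why the analytic lemmas admit
  exponents above -1 and not only positive ones.

  The remainder uses only linearity, positivity, M_a((x - a) p) = L p, integration by parts and the
  derivative rules, hence it is carried out for abstract functionals. No differential equation in x
  is derived. The relation U_a W_a = V_a (V_a - \<theta>_a) is a Casorati identity; it says that the
  matrix with rows (V_a - \<theta>_a/2, U_a) and (-W_a, \<theta>_a/2 - V_a) has determinant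
  -\<theta>_a^2/4, so its eigenvalues do not depend on t.\<close>

hide_const (open) Module.smult

section \<open>Moments of the weight\<close>

text \<open>The substitution \<open>r = (x / t) powr (a + 1)\<close> absorbs the singularity of \<open>x powr a\<close> at \<open>0\<close>, so
  that the Leibniz rule for continuous integrands applies to incomplete beta integrals.\<close>

definition beta_kernel :: "real \<Rightarrow> real \<Rightarrow> (real \<Rightarrow> real) \<Rightarrow> real \<Rightarrow> real \<Rightarrow> real" where
  "beta_kernel a c h t r = (1 - r powr (1 / (a + 1))) powr c * h (t * r powr (1 / (a + 1)))"

lemma continuous_on_beta_kernel:
  assumes "a > -1" "c > 0" "t > 0" "continuous_on {0..t} h"
  shows "continuous_on {0..1} (beta_kernel a c h t)"
proof -
  have r: "0 \<le> r powr (1 / (a + 1)) \<and> r powr (1 / (a + 1)) \<le> 1" if "r \<in> {0..1}" for r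
    using that assms by (auto intro!: powr_le1)
  have 1: "continuous_on {0..1} (\<lambda>r::real. r powr (1 / (a + 1)))"
    using assms by (intro continuous_on_powr') (auto intro!: continuous_intros)
  have 2: "continuous_on {0..1} (\<lambda>r. h (t * r powr (1 / (a + 1))))"
    using r assms by (intro continuous_on_compose2[OF assms(4)] continuous_intros 1)
      (auto simp: mult_left_le)
  have 3: "continuous_on {0..1} (\<lambda>r. (1 - r powr (1 / (a + 1))) powr c)"
    using r assms by (intro continuous_on_powr' continuous_intros 1) auto
  show ?thesis
    unfolding beta_kernel_def by (intro continuous_on_mult 2 3)
qed

lemma has_integral_beta_kernel:
  assumes "a > -1" "c > 0" "t > 0" "continuous_on {0..t} h"
  shows "((\<lambda>x. x powr a * (t - x) powr c * h x) has_integral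
           (t powr (a + c + 1) / (a + 1) * integral {0..1} (beta_kernel a c h t))) {0..t}"
proof -
  let ?g = "\<lambda>x. (x / t) powr (a + 1)" and ?g' = "\<lambda>x. (a + 1) * (x / t) powr a / t"
  have "((\<lambda>x. ?g' x *\<^sub>R beta_kernel a c h t (?g x)) has_integral
          (integral {?g 0..?g t} (beta_kernel a c h t))) {0..t}"
  proof (rule has_integral_substitution_strong[of "{0}" _ _ _ 0 1])
    show "?g ` {0..t} \<subseteq> {0..1}"
      using assms by (auto intro!: powr_le1)
    show "continuous_on {0..1} (beta_kernel a c h t)"
      by (rule continuous_on_beta_kernel[OF assms])
    show "continuous_on {0..t} ?g"
      using assms by (intro continuous_on_powr') (auto intro!: continuous_intros)
    show "(?g has_field_derivative ?g' x) (at x within {0..t})" if "x \<in> {0..t} - {0}" for x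
    proof (rule has_field_derivative_at_within)
      have "(?g has_real_derivative (a + 1) * (x / t) powr (a + 1 - of_nat 1) * (1 / t)) (at x)"
        using that assms by (intro DERIV_fun_powr DERIV_cdivide DERIV_ident) auto
      then show "(?g has_real_derivative ?g' x) (at x)"
        by simp
    qed
  qed (use assms in auto)
  then have int: "((\<lambda>x. (t powr (a + c + 1) / (a + 1)) * (?g' x *\<^sub>R beta_kernel a c h t (?g x))) has_integral
      (t powr (a + c + 1) / (a + 1)) * integral {0..1} (beta_kernel a c h t)) {0..t}"
    using assms by (intro has_integral_mult_right) simp
  have eq: "x powr a * (t - x) powr c * h x =
      (t powr (a + c + 1) / (a + 1)) * (?g' x *\<^sub>R beta_kernel a c h t (?g x))" if "x \<in> {0..t} - {0}" for x
  proof -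
    have x: "?g x powr (1 / (a + 1)) = x / t"
      using that assms by (simp add: powr_powr)
    have "1 - x / t = (t - x) / t"
      using assms by (simp add: field_simps)
    then have k: "beta_kernel a c h t (?g x) = (t - x) powr c / t powr c * h x"
      unfolding beta_kernel_def x using that assms by (simp add: powr_divide)
    have split: "X * Z * H = (Y * W * t / d) * (d * (X / Y) / t * (Z / W * H))"
      if "Y > 0" "W > 0" "d > 0" for X Y Z W H d :: real
      using that assms by (simp add: field_simps)
    show ?thesis
      unfolding k using split[of "t powr a" "t powr c" "a + 1" "x powr a" "(t - x) powr c" "h x"] that assms
      by (simp add: powr_divide powr_add)
  qed
  show ?thesis
    by (rule has_integral_spike_finite[where S = "{0}", OF _ eq int]) auto
qed

section \<open>Incomplete beta integrals and their derivative in the endpoint\<close>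

definition beta_part :: "real \<Rightarrow> real \<Rightarrow> real \<Rightarrow> real \<Rightarrow> real" where
  "beta_part a b c t = integral {0..t} (\<lambda>x. x powr a * (1 - x) powr b * (t - x) powr c)"

lemma has_integral_beta_part_kernel:
  assumes "a > -1" "c > 0" "0 < t" "t < 1"
  shows "((\<lambda>x. x powr a * (1 - x) powr b * (t - x) powr c) has_integral
           (t powr (a + c + 1) / (a + 1) * integral {0..1} (beta_kernel a c (\<lambda>x. (1 - x) powr b) t))) {0..t}"
proof -
  have "((\<lambda>x. x powr a * (t - x) powr c * (1 - x) powr b) has_integral
           (t powr (a + c + 1) / (a + 1) * integral {0..1} (beta_kernel a c (\<lambda>x. (1 - x) powr b) t))) {0..t}"
    using assms by (intro has_integral_beta_kernel) (auto intro!: continuous_intros)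
  then show ?thesis
    by (simp add: mult_ac)
qed

lemma integrable_beta_part:
  fixes a b c t :: real
  assumes "a > -1" "c > 0" "0 < t" "t < 1"
  shows "(\<lambda>x. x powr a * (1 - x) powr b * (t - x) powr c) integrable_on {0..t}"
  using has_integral_beta_part_kernel[OF assms] by blast

lemma has_integral_beta_part:
  assumes "a > -1" "c > 0" "0 < t" "t < 1"
  shows "((\<lambda>x. x powr a * (1 - x) powr b * (t - x) powr c) has_integral beta_part a b c t) {0..t}"
  unfolding beta_part_def using integrable_beta_part[OF assms] by (rule integrable_integral)

text \<open>The antiderivative \<open>x powr (a + 1) * (1 - x) powr b * (t - x) powr c\<close>
  vanishes at both ends. Two of the three terms of its derivative are known to be integrable, hence
  so is the third, even for negative \<open>c - 1\<close>; no separate convergence argument is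
  needed.\<close>

lemma has_integral_beta_part_parts:
  assumes "a > -1" "c > 0" "0 < t" "t < 1"
  shows "((\<lambda>x. c * (x powr (a + 1) * (1 - x) powr b * (t - x) powr (c - 1))) has_integral
           ((a + 1) * beta_part a b c t - b * beta_part (a + 1) (b - 1) c t)) {0..t}"
proof -
  let ?F = "\<lambda>x. x powr (a + 1) * (1 - x) powr b * (t - x) powr c"
  let ?F' = "\<lambda>x. (a + 1) * (x powr a * (1 - x) powr b * (t - x) powr c)
      - b * (x powr (a + 1) * (1 - x) powr (b - 1) * (t - x) powr c)
      - c * (x powr (a + 1) * (1 - x) powr b * (t - x) powr (c - 1))"
  have "(?F' has_integral (?F t - ?F 0)) {0..t}"
  proof (rule fundamental_theorem_of_calculus_interior)
    show "continuous_on {0..t} ?F"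
      using assms by (intro continuous_on_mult continuous_on_powr') (auto intro!: continuous_intros)
    show "(?F has_vector_derivative ?F' x) (at x)" if "x \<in> {0<..<t}" for x
    proof -
      have "((\<lambda>x. x powr (a + 1)) has_real_derivative (a + 1) * x powr (a + 1 - 1)) (at x)"
        using that by (intro has_real_derivative_powr) auto
      moreover have "((\<lambda>x. (1 - x) powr b) has_real_derivative b * (1 - x) powr (b - of_nat 1) * (0 - 1)) (at x)"
        using that assms by (intro DERIV_fun_powr DERIV_diff DERIV_const DERIV_ident) auto
      moreover have "((\<lambda>x. (t - x) powr c) has_real_derivative c * (t - x) powr (c - of_nat 1) * (0 - 1)) (at x)"
        using that assms by (intro DERIV_fun_powr DERIV_diff DERIV_const DERIV_ident) auto
      ultimately have "(?F has_real_derivative ?F' x) (at x)"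
        by (intro DERIV_cong[OF DERIV_mult[OF DERIV_mult]]) (assumption+, simp add: algebra_simps)
      then show ?thesis
        by (simp add: has_real_derivative_iff_has_vector_derivative)
    qed
  qed (use assms in auto)
  then have F: "(?F' has_integral 0) {0..t}"
    using assms by simp
  have "((\<lambda>x. (a + 1) * (x powr a * (1 - x) powr b * (t - x) powr c)
      - b * (x powr (a + 1) * (1 - x) powr (b - 1) * (t - x) powr c) - ?F' x) has_integral
      ((a + 1) * beta_part a b c t - b * beta_part (a + 1) (b - 1) c t - 0)) {0..t}"
    using assms by (intro has_integral_diff has_integral_mult_right has_integral_beta_part F) auto
  then show ?thesis
    by simp
qed

text \<open>The exponent of \<open>t - x\<close> is lowered by writing \<open>t = (t - x) + x\<close> and integrating the second
  part by parts.\<close>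

lemma has_integral_beta_part_pred:
  assumes "a > -1" "c > 0" "0 < t" "t < 1"
  shows "((\<lambda>x. x powr a * (1 - x) powr b * (t - x) powr (c - 1)) has_integral
           (((a + c + 1) * beta_part a b c t - b * beta_part (a + 1) (b - 1) c t) / (c * t))) {0..t}"
proof -
  have int: "((\<lambda>x. (c * (x powr a * (1 - x) powr b * (t - x) powr c)
           + c * (x powr (a + 1) * (1 - x) powr b * (t - x) powr (c - 1))) / (c * t)) has_integral
        ((c * beta_part a b c t + ((a + 1) * beta_part a b c t - b * beta_part (a + 1) (b - 1) c t)) / (c * t))) {0..t}"
    using assms
    by (intro has_integral_divide has_integral_add has_integral_mult_right
          has_integral_beta_part has_integral_beta_part_parts) auto
  have sum: "c * beta_part a b c t + ((a + 1) * beta_part a b c t - b * beta_part (a + 1) (b - 1) c t)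
      = (a + c + 1) * beta_part a b c t - b * beta_part (a + 1) (b - 1) c t"
    by (simp add: algebra_simps)
  have eq: "x powr a * (1 - x) powr b * (t - x) powr (c - 1) = (c * (x powr a * (1 - x) powr b * (t - x) powr c)
           + c * (x powr (a + 1) * (1 - x) powr b * (t - x) powr (c - 1))) / (c * t)"
    if "x \<in> {0..t} - {0, t}" for x
  proof -
    have 1: "x powr (a + 1) = x * x powr a"
      using that assms by (simp add: powr_add)
    have 2: "(t - x) powr c = (t - x) * (t - x) powr (c - 1)"
      using that assms by (simp add: powr_diff)
    show ?thesis
      unfolding 1 2 using assms by (simp add: field_simps)
  qed
  show ?thesis
    by (rule has_integral_spike_finite[where S = "{0, t}", OF _ eq int[unfolded sum]]) auto
qed

text \<open>After the substitution, t occurs only in \<open>t powr (a + c + 1)\<close> and in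
  \<open>(1 - t * r powr (1 / (a + 1))) powr b\<close>, whose base stays positive for t < 1. The two
  resulting terms add up to the value in \<open>has_integral_beta_part_pred\<close>.\<close>

lemma has_real_derivative_beta_part:
  assumes "a > -1" "c > 0" "0 < t" "t < 1"
  shows "(beta_part a b c has_real_derivative c * beta_part a b (c - 1) t) (at t)"
proof -
  let ?k = "\<lambda>r::real. r powr (1 / (a + 1))"
  let ?f = "\<lambda>t. beta_kernel a c (\<lambda>x. (1 - x) powr b) t"
  \<comment> \<open>The derivative in t is again a \<open>beta_kernel\<close>, now with h(x) =
    -(b/t) x (1 - x)^(b - 1), so it can be carried back to an integral over [0, t].\<close>
  let ?f' = "\<lambda>t r. beta_kernel a c (\<lambda>x. -b / t * (x * (1 - x) powr (b - 1))) t r"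
  let ?C = "\<lambda>t. t powr (a + c + 1) / (a + 1)"
  have k: "0 \<le> ?k r" "?k r \<le> 1" "s * ?k r < 1" if "r \<in> {0..1}" "s \<in> {0<..<1}" for r s
  proof -
    show *: "0 \<le> ?k r" "?k r \<le> 1"
      using that assms by (auto intro!: powr_le1)
    have "s * ?k r \<le> s * 1"
      using * that by (intro mult_left_mono) auto
    also have "\<dots> < 1" using that by simp
    finally show "s * ?k r < 1" .
  qed
  have "((\<lambda>s. integral (cbox 0 1) (?f s)) has_field_derivative integral (cbox 0 1) (?f' t)) (at t within {0<..<1})"
  proof (rule leibniz_rule_field_derivative)
    fix s r :: real assume s: "s \<in> {0<..<1}" and r: "r \<in> cbox 0 1"
    have "1 - s * ?k r > 0" using k[of r s] r s by simp
    then have "((\<lambda>s. (1 - s * ?k r) powr b) has_real_derivative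
        b * (1 - s * ?k r) powr (b - of_nat 1) * (0 - 1 * ?k r)) (at s)"
      by (intro DERIV_fun_powr DERIV_diff DERIV_const DERIV_cmult_right DERIV_ident)
    then have "((\<lambda>s. ?f s r) has_field_derivative
        (1 - ?k r) powr c * (b * (1 - s * ?k r) powr (b - of_nat 1) * (0 - 1 * ?k r))) (at s)"
      unfolding beta_kernel_def by (intro DERIV_cmult)
    moreover have "(1 - ?k r) powr c * (b * (1 - s * ?k r) powr (b - of_nat 1) * (0 - 1 * ?k r)) = ?f' s r"
      unfolding beta_kernel_def using s by simp
    ultimately show "((\<lambda>s. ?f s r) has_field_derivative ?f' s r) (at s within {0<..<1})"
      by (metis has_field_derivative_at_within)
  next
    fix s :: real assume "s \<in> {0<..<1}"
    then show "?f s integrable_on cbox 0 1"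
      using assms by (intro integrable_continuous continuous_on_beta_kernel[of a c s, folded box_real])
         (auto intro!: continuous_intros)
  next
    have kc: "continuous_on ({0<..<1} \<times> {0..1}) (\<lambda>z::real \<times> real. ?k (snd z))"
      using assms by (intro continuous_on_powr') (auto intro!: continuous_intros)
    have k1: "1 - fst z * ?k (snd z) \<noteq> 0" if "z \<in> {0<..<1} \<times> {0..1}" for z :: "real \<times> real"
      using k[of "snd z" "fst z"] that by (auto simp: mem_Times_iff)
    have k2: "0 \<le> 1 - ?k (snd z)" if "z \<in> {0<..<1} \<times> {0..1}" for z :: "real \<times> real"
      using k[of "snd z" "fst z"] that by (auto simp: mem_Times_iff)
    have c1: "continuous_on ({0<..<1} \<times> {0..1}) (\<lambda>z::real \<times> real. (1 - ?k (snd z)) powr c)"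
      using k2 assms by (intro continuous_on_powr' continuous_on_diff kc continuous_on_const) auto
    have c2: "continuous_on ({0<..<1} \<times> {0..1}) (\<lambda>z::real \<times> real. fst z * ?k (snd z))"
      by (intro continuous_on_mult kc continuous_on_fst[OF continuous_on_id])
    have c3: "continuous_on ({0<..<1} \<times> {0..1}) (\<lambda>z::real \<times> real. (1 - fst z * ?k (snd z)) powr (b - 1))"
      using k1 by (intro continuous_on_powr continuous_on_diff c2 continuous_on_const) auto
    have c4: "continuous_on ({0<..<1} \<times> {0..1}) (\<lambda>z::real \<times> real. - b / fst z)"
      by (intro continuous_on_divide continuous_on_const continuous_on_fst[OF continuous_on_id]) auto
    have "continuous_on ({0<..<1} \<times> {0..1}) (\<lambda>z::real \<times> real. ?f' (fst z) (snd z))"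
      unfolding beta_kernel_def
      by (rule continuous_on_mult[OF c1 continuous_on_mult[OF c4 continuous_on_mult[OF c2 c3]]])
    then show "continuous_on ({0<..<1} \<times> cbox 0 1) (\<lambda>(s, r). ?f' s r)"
      by (simp add: case_prod_unfold)
  qed (use assms in auto)
  then have f: "((\<lambda>s. integral {0..1} (?f s)) has_field_derivative integral {0..1} (?f' t)) (at t)"
    using assms by (simp add: at_within_open[of t "{0<..<1}"])
  have C: "(?C has_field_derivative ((a + c + 1) / t * ?C t)) (at t)"
  proof -
    have "((\<lambda>t. t powr (a + c + 1)) has_real_derivative (a + c + 1) * t powr (a + c + 1 - 1)) (at t)"
      using assms by (intro has_real_derivative_powr) auto
    moreover have "t powr (a + c + 1) = t * t powr (a + c + 1 - 1)"
      using assms powr_mult_base[of t "a + c"] by (simp add: add_ac)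
    ultimately show ?thesis
      using assms DERIV_cdivide[of _ _ t UNIV "a + 1"] by auto
  qed
  have "((\<lambda>s. ?C s * integral {0..1} (?f s)) has_field_derivative
     (a + c + 1) / t * ?C t * integral {0..1} (?f t) + integral {0..1} (?f' t) * ?C t) (at t)"
    by (rule DERIV_mult[OF C f])
  moreover have eq: "beta_part a b c s = ?C s * integral {0..1} (?f s)" if "s \<in> {0<..<1}" for s
    unfolding beta_part_def using that assms by (intro integral_unique has_integral_beta_part_kernel) auto
  moreover have "((\<lambda>x. x powr a * (t - x) powr c * (-b / t * (x * (1 - x) powr (b - 1)))) has_integral
     (?C t * integral {0..1} (?f' t))) {0..t}"
    using assms by (intro has_integral_beta_kernel) (auto intro!: continuous_intros)
  moreover have "((\<lambda>x. x powr a * (t - x) powr c * (-b / t * (x * (1 - x) powr (b - 1)))) has_integral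
     (-b / t * beta_part (a + 1) (b - 1) c t)) {0..t}"
  proof (rule has_integral_eq)
    show "((\<lambda>x. -b / t * (x powr (a + 1) * (1 - x) powr (b - 1) * (t - x) powr c)) has_integral
        (-b / t * beta_part (a + 1) (b - 1) c t)) {0..t}"
      using assms by (intro has_integral_mult_right has_integral_beta_part) auto
  qed (use assms in \<open>auto simp: powr_add\<close>)
  ultimately have "((\<lambda>s. ?C s * integral {0..1} (?f s)) has_field_derivative
     (a + c + 1) / t * beta_part a b c t - b / t * beta_part (a + 1) (b - 1) c t) (at t)"
    using assms by (auto simp: mult_ac dest: has_integral_unique)
  moreover have "(a + c + 1) / t * beta_part a b c t - b / t * beta_part (a + 1) (b - 1) c t
      = c * beta_part a b (c - 1) t"
    unfolding beta_part_def[of a b "c - 1"] integral_unique[OF has_integral_beta_part_pred[OF assms]]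
    using assms by (simp add: field_simps)
  ultimately have "((\<lambda>s. ?C s * integral {0..1} (?f s)) has_field_derivative c * beta_part a b (c - 1) t) (at t)"
    by simp
  then show ?thesis
    using eq assms by (rule_tac has_field_derivative_transform_within_open[of _ _ _ "{0<..<1}"]) auto
qed

section \<open>Integrals of polynomials against the weight, and their t-derivatives\<close>

lemma has_integral_one_minus:
  fixes f :: "real \<Rightarrow> real"
  assumes "(f has_integral i) {0..1 - t}"
  shows "((\<lambda>x. f (1 - x)) has_integral i) {t..1}"
proof -
  have "((\<lambda>x. f (-1 *\<^sub>R x + 1)) has_integral (1 / \<bar>-1\<bar> ^ DIM(real)) *\<^sub>R i)
      ((\<lambda>x. (1 / -1) *\<^sub>R x + - ((1 / -1) *\<^sub>R 1)) ` cbox 0 (1 - t))"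
    using assms by (intro has_integral_affinity) auto
  moreover have "(\<lambda>x. (1 / -1) *\<^sub>R x + - ((1 / -1) *\<^sub>R 1)) ` cbox 0 (1 - t) = {t..1}"
    using image_diff_atLeastAtMost[of 1 0 "1 - t"] by simp
  ultimately show ?thesis
    by simp
qed

lemma has_integral_beta_part_pred':
  fixes a b c t :: real
  assumes "a > -1" "c > 0" "0 < t" "t < 1"
  shows "((\<lambda>x. x powr a * (1 - x) powr b * (t - x) powr (c - 1)) has_integral beta_part a b (c - 1) t) {0..t}"
  unfolding beta_part_def
  by (rule integrable_integral[OF has_integral_integrable[OF has_integral_beta_part_pred[OF assms]]])

lemma wt_at_singularity: "\<gamma> > 0 \<Longrightarrow> wt a b \<gamma> A B t t = 0"
  by (simp add: wt_def)

text \<open>The weight is cut at t. On the right, x -> 1 - x exchanges a with b and t with 1 - t, so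
  both pieces are values of \<open>beta_part\<close>.\<close>

lemma has_integral_wt:
  assumes "a > -1" "b > -1" "\<gamma> > 0" "0 < t" "t < 1"
  shows "((\<lambda>x. wt a b \<gamma> A B x t) has_integral
           A * beta_part a b \<gamma> t + (A + B) * beta_part b a \<gamma> (1 - t)) {0..1}"
proof (rule has_integral_combine)
  have "((\<lambda>x. A * (x powr a * (1 - x) powr b * (t - x) powr \<gamma>)) has_integral A * beta_part a b \<gamma> t) {0..t}"
    using assms by (intro has_integral_mult_right has_integral_beta_part) auto
  then show "((\<lambda>x. wt a b \<gamma> A B x t) has_integral A * beta_part a b \<gamma> t) {0..t}"
    by (rule has_integral_eq[rotated]) (auto simp: wt_def heaviside_def)
  have "((\<lambda>x. (A + B) * (x powr b * (1 - x) powr a * (1 - t - x) powr \<gamma>)) has_integral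
      (A + B) * beta_part b a \<gamma> (1 - t)) {0..1 - t}"
    using assms by (intro has_integral_mult_right has_integral_beta_part) auto
  from has_integral_one_minus[OF this]
  show "((\<lambda>x. wt a b \<gamma> A B x t) has_integral (A + B) * beta_part b a \<gamma> (1 - t)) {t..1}"
    by (rule has_integral_eq[rotated]) (use assms in \<open>auto simp: wt_def heaviside_def\<close>)
qed (use assms in auto)

lemma has_integral_wt_cauchy:
  assumes "a > -1" "b > -1" "\<gamma> > 0" "0 < t" "t < 1"
  shows "((\<lambda>x. wt a b \<gamma> A B x t / (x - t)) has_integral
           - A * beta_part a b (\<gamma> - 1) t + (A + B) * beta_part b a (\<gamma> - 1) (1 - t)) {0..1}"
proof (rule has_integral_combine)
  have "((\<lambda>x. - A * (x powr a * (1 - x) powr b * (t - x) powr (\<gamma> - 1))) has_integral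
      - A * beta_part a b (\<gamma> - 1) t) {0..t}"
    using assms by (intro has_integral_mult_right has_integral_beta_part_pred') auto
  then show "((\<lambda>x. wt a b \<gamma> A B x t / (x - t)) has_integral - A * beta_part a b (\<gamma> - 1) t) {0..t}"
  proof (rule has_integral_eq[rotated])
    fix x assume x: "x \<in> {0..t}"
    show "- A * (x powr a * (1 - x) powr b * (t - x) powr (\<gamma> - 1)) = wt a b \<gamma> A B x t / (x - t)"
    proof (cases "x = t")
      case False
      then have "(t - x) powr (\<gamma> - 1) = - ((t - x) powr \<gamma> / (x - t))"
        using x by (simp add: powr_diff minus_divide_right)
      then show ?thesis
        using x False by (simp add: wt_def heaviside_def)
    qed (simp add: wt_def)
  qed
  have "((\<lambda>x. (A + B) * (x powr b * (1 - x) powr a * (1 - t - x) powr (\<gamma> - 1))) has_integral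
      (A + B) * beta_part b a (\<gamma> - 1) (1 - t)) {0..1 - t}"
    using assms by (intro has_integral_mult_right has_integral_beta_part_pred') auto
  from has_integral_one_minus[OF this]
  show "((\<lambda>x. wt a b \<gamma> A B x t / (x - t)) has_integral (A + B) * beta_part b a (\<gamma> - 1) (1 - t)) {t..1}"
  proof (rule has_integral_eq[rotated])
    fix x assume x: "x \<in> {t..1}"
    show "(A + B) * ((1 - x) powr b * (1 - (1 - x)) powr a * (1 - t - (1 - x)) powr (\<gamma> - 1))
        = wt a b \<gamma> A B x t / (x - t)"
    proof (cases "x = t")
      case False
      then have "(x - t) powr (\<gamma> - 1) = (x - t) powr \<gamma> / (x - t)"
        using x by (simp add: powr_diff)
      then show ?thesis
        using x False by (simp add: wt_def heaviside_def)
    qed (simp add: wt_def)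
  qed
qed (use assms in auto)

text \<open>The left piece contributes with factor \<gamma>, the right one, which depends on 1 - t,
  with -\<gamma>. Dividing by x - t rather than |x - t| absorbs the difference of sign.\<close>

lemma has_real_derivative_integral_wt:
  assumes "a > -1" "b > -1" "\<gamma> > 0" "0 < t" "t < 1"
  shows "((\<lambda>s. integral {0..1} (\<lambda>x. wt a b \<gamma> A B x s)) has_real_derivative
           - \<gamma> * integral {0..1} (\<lambda>x. wt a b \<gamma> A B x t / (x - t))) (at t)"
proof -
  have "((\<lambda>s. beta_part b a \<gamma> (1 - s)) has_real_derivative \<gamma> * beta_part b a (\<gamma> - 1) (1 - t) * (0 - 1)) (at t)"
    by (rule DERIV_chain'[OF DERIV_diff[OF DERIV_const DERIV_ident] has_real_derivative_beta_part])
      (use assms in auto)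
  moreover have "(beta_part a b \<gamma> has_real_derivative \<gamma> * beta_part a b (\<gamma> - 1) t) (at t)"
    using assms by (intro has_real_derivative_beta_part) auto
  ultimately have deriv: "((\<lambda>s. A * beta_part a b \<gamma> s + (A + B) * beta_part b a \<gamma> (1 - s)) has_real_derivative
     A * (\<gamma> * beta_part a b (\<gamma> - 1) t) + (A + B) * (\<gamma> * beta_part b a (\<gamma> - 1) (1 - t) * (0 - 1))) (at t)"
    by (intro DERIV_add DERIV_cmult)
  have val: "A * (\<gamma> * beta_part a b (\<gamma> - 1) t) + (A + B) * (\<gamma> * beta_part b a (\<gamma> - 1) (1 - t) * (0 - 1))
      = - \<gamma> * integral {0..1} (\<lambda>x. wt a b \<gamma> A B x t / (x - t))"
    unfolding integral_unique[OF has_integral_wt_cauchy[OF assms]] by (simp add: algebra_simps)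
  have eq: "integral {0..1} (\<lambda>x. wt a b \<gamma> A B x s) = A * beta_part a b \<gamma> s + (A + B) * beta_part b a \<gamma> (1 - s)"
    if "s \<in> {0<..<1}" for s
    using has_integral_wt[of a b \<gamma> s] that assms by (intro integral_unique) auto
  show ?thesis
    by (rule has_field_derivative_transform_within_open[OF deriv[unfolded val], of "{0<..<1}"])
      (use assms eq in auto)
qed

text \<open>Multiplication by x^i only raises the exponent a by i. Integrals of polynomials thus
  become finite sums over shifted weights, and the derivative rule extends to them term by
  term.\<close>

lemma poly_mult_wt:
  assumes "x \<ge> 0"
  shows "poly p x * wt a b \<gamma> A B x t = (\<Sum>i\<le>degree p. coeff p i * wt (a + real i) b \<gamma> A B x t)"
proof -
  have "x ^ i * x powr a = x powr (a + real i)" for i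
    using assms by (cases "x = 0") (auto simp: powr_add powr_realpow mult.commute)
  then have "x ^ i * wt a b \<gamma> A B x t = wt (a + real i) b \<gamma> A B x t" for i
    by (simp add: wt_def mult.assoc[symmetric])
  then show ?thesis
    by (simp add: poly_altdef sum_distrib_right mult.assoc)
qed

lemma has_integral_poly_wt:
  assumes "a > -1" "b > -1" "\<gamma> > 0" "0 < t" "t < 1"
  shows "((\<lambda>x. poly p x * wt a b \<gamma> A B x t) has_integral
           (\<Sum>i\<le>degree p. coeff p i * integral {0..1} (\<lambda>x. wt (a + real i) b \<gamma> A B x t))) {0..1}"
proof -
  have "((\<lambda>x. \<Sum>i\<le>degree p. coeff p i * wt (a + real i) b \<gamma> A B x t) has_integral
     (\<Sum>i\<le>degree p. coeff p i * integral {0..1} (\<lambda>x. wt (a + real i) b \<gamma> A B x t))) {0..1}"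
    using assms has_integral_wt[of "a + real i" b \<gamma> t A B for i]
    by (intro has_integral_sum has_integral_mult_right integrable_integral) (auto simp: integrable_on_def)
  then show ?thesis
    by (rule has_integral_eq[rotated]) (simp add: poly_mult_wt)
qed

lemma has_integral_poly_wt_cauchy:
  assumes "a > -1" "b > -1" "\<gamma> > 0" "0 < t" "t < 1"
  shows "((\<lambda>x. poly p x * (wt a b \<gamma> A B x t / (x - t))) has_integral
           (\<Sum>i\<le>degree p. coeff p i * integral {0..1} (\<lambda>x. wt (a + real i) b \<gamma> A B x t / (x - t)))) {0..1}"
proof -
  have "((\<lambda>x. \<Sum>i\<le>degree p. coeff p i * (wt (a + real i) b \<gamma> A B x t / (x - t))) has_integral
     (\<Sum>i\<le>degree p. coeff p i * integral {0..1} (\<lambda>x. wt (a + real i) b \<gamma> A B x t / (x - t)))) {0..1}"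
    using assms has_integral_wt_cauchy[of "a + real i" b \<gamma> t A B for i]
    by (intro has_integral_sum has_integral_mult_right integrable_integral) (auto simp: integrable_on_def)
  then show ?thesis
    by (rule has_integral_eq[rotated]) (simp add: poly_mult_wt sum_divide_distrib)
qed

lemma has_real_derivative_integral_poly_wt:
  assumes "a > -1" "b > -1" "\<gamma> > 0" "0 < t" "t < 1"
  shows "((\<lambda>s. integral {0..1} (\<lambda>x. poly p x * wt a b \<gamma> A B x s)) has_real_derivative
           - \<gamma> * integral {0..1} (\<lambda>x. poly p x * (wt a b \<gamma> A B x t / (x - t)))) (at t)"
proof -
  have deriv: "((\<lambda>s. \<Sum>i\<le>degree p. coeff p i * integral {0..1} (\<lambda>x. wt (a + real i) b \<gamma> A B x s)) has_real_derivative
     (\<Sum>i\<le>degree p. coeff p i * (- \<gamma> * integral {0..1} (\<lambda>x. wt (a + real i) b \<gamma> A B x t / (x - t))))) (at t)"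
    using assms by (intro DERIV_sum DERIV_cmult has_real_derivative_integral_wt) auto
  have val: "(\<Sum>i\<le>degree p. coeff p i * (- \<gamma> * integral {0..1} (\<lambda>x. wt (a + real i) b \<gamma> A B x t / (x - t))))
     = - \<gamma> * integral {0..1} (\<lambda>x. poly p x * (wt a b \<gamma> A B x t / (x - t)))"
    unfolding integral_unique[OF has_integral_poly_wt_cauchy[OF assms]] sum_distrib_left
    by (simp add: mult_ac)
  have eq: "integral {0..1} (\<lambda>x. poly p x * wt a b \<gamma> A B x s)
      = (\<Sum>i\<le>degree p. coeff p i * integral {0..1} (\<lambda>x. wt (a + real i) b \<gamma> A B x s))"
    if "s \<in> {0<..<1}" for s
    using has_integral_poly_wt[of a b \<gamma> s] that assms by (intro integral_unique) auto
  show ?thesis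
    by (rule has_field_derivative_transform_within_open[OF deriv[unfolded val], of "{0<..<1}"])
      (use assms eq in auto)
qed

section \<open>Continuity and logarithmic derivative of the weight in x\<close>

lemma continuous_on_wt:
  assumes "a > 0" "b > 0" "\<gamma> > 0"
  shows "continuous_on {0..1} (\<lambda>x. wt a b \<gamma> A B x t)"
proof -
  \<comment> \<open>The jump at t is harmless, as each branch carries |x - t|^\<gamma>. Written with
    \<open>max\<close>, each branch is continuous on the whole interval.\<close>
  have "continuous_on {0..1} (\<lambda>x. x powr a * (1 - x) powr b *
      (A * max 0 (t - x) powr \<gamma> + (A + B) * max 0 (x - t) powr \<gamma>))"
    using assms by (intro continuous_on_mult continuous_on_add continuous_on_powr') (auto intro!: continuous_intros)
  then show ?thesis
    by (rule continuous_on_eq) (use assms in \<open>auto simp: wt_def heaviside_def max_def\<close>)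
qed

lemma has_real_derivative_wt:
  assumes "0 < x" "x < 1" "x \<noteq> t"
  shows "((\<lambda>x. wt a b \<gamma> A B x t) has_real_derivative
           wt a b \<gamma> A B x t * (a / x + b / (x - 1) + \<gamma> / (x - t))) (at x)"
proof -
  have xa: "((\<lambda>x. x powr a) has_real_derivative a * x powr (a - 1)) (at x)"
    using assms by (intro has_real_derivative_powr) auto
  have xb: "((\<lambda>x. (1 - x) powr b) has_real_derivative b * (1 - x) powr (b - of_nat 1) * (0 - 1)) (at x)"
    using assms by (intro DERIV_fun_powr DERIV_diff DERIV_const DERIV_ident) auto
  \<comment> \<open>On the side \<open>S\<close> of t that contains x, the step factor is the
    constant \<open>c\<close> and |y - t| = e (y - t), which leaves a smooth formula to
    differentiate.\<close>
  define c where "c = A + B * heaviside (x - t)"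
  define e where "e = sgn (x - t)"
  define S where "S = (if x > t then {t<..} else {..<t})"
  have S: "open S" "x \<in> S" "\<And>y. y \<in> S \<Longrightarrow> \<bar>y - t\<bar> = e * (y - t)"
      "\<And>y. y \<in> S \<Longrightarrow> A + B * heaviside (y - t) = c"
    using assms by (auto simp: S_def e_def c_def heaviside_def split: if_splits)
  have e: "e * (x - t) > 0"
    using assms by (simp add: e_def sgn_if)
  have xt: "((\<lambda>x. (e * (x - t)) powr \<gamma>) has_real_derivative \<gamma> * ((e * (x - t)) powr \<gamma> / (x - t))) (at x)"
  proof (rule DERIV_cong)
    show "((\<lambda>x. (e * (x - t)) powr \<gamma>) has_real_derivative
        \<gamma> * (e * (x - t)) powr (\<gamma> - of_nat 1) * (e * (1 - 0))) (at x)"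
      using e by (intro DERIV_fun_powr DERIV_cmult DERIV_diff DERIV_const DERIV_ident) auto
  qed (use e in \<open>simp add: powr_diff\<close>)
  have eqs: "x powr (a - 1) = x powr a / x" "(1 - x) powr (b - of_nat 1) = - ((1 - x) powr b / (x - 1))"
    using assms by (auto simp: powr_diff minus_divide_right)
  have "((\<lambda>x. x powr a * (1 - x) powr b * (e * (x - t)) powr \<gamma> * c) has_real_derivative
      x powr a * (1 - x) powr b * (e * (x - t)) powr \<gamma> * c * (a / x + b / (x - 1) + \<gamma> / (x - t))) (at x)"
    by (rule DERIV_cong[OF DERIV_cmult_right[OF DERIV_mult[OF DERIV_mult[OF xa xb] xt]]],
        unfold eqs) (simp add: divide_inverse algebra_simps)
  then have "((\<lambda>x. x powr a * (1 - x) powr b * (e * (x - t)) powr \<gamma> * c) has_real_derivative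
      wt a b \<gamma> A B x t * (a / x + b / (x - 1) + \<gamma> / (x - t))) (at x)"
    using S by (simp add: wt_def)
  then show ?thesis
    by (rule has_field_derivative_transform_within_open[OF _ S(1,2)]) (simp add: wt_def S)
qed

section \<open>The functionals L and M_a of the weight\<close>

definition weight_int :: "real \<Rightarrow> real \<Rightarrow> real \<Rightarrow> real \<Rightarrow> real \<Rightarrow> real \<Rightarrow> real poly \<Rightarrow> real" where
  "weight_int a b \<gamma> A B t p = integral {0..1} (\<lambda>x. poly p x * wt a b \<gamma> A B x t)"

text \<open>This is M_t. Unlike M_0 and M_1 it is not \<open>weight_int\<close> with a lowered
  exponent: lowering \<gamma> would give 1 / |x - t| in place of 1 / (x - t).\<close>

definition weight_cauchy :: "real \<Rightarrow> real \<Rightarrow> real \<Rightarrow> real \<Rightarrow> real \<Rightarrow> real \<Rightarrow> real poly \<Rightarrow> real" where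
  "weight_cauchy a b \<gamma> A B t p = integral {0..1} (\<lambda>x. poly p x * (wt a b \<gamma> A B x t / (x - t)))"

context
  fixes a b \<gamma> A B t :: real
  assumes ab: "a > -1" "b > -1" "\<gamma> > 0" "0 < t" "t < 1"
begin

lemma has_integral_weight_int:
  "((\<lambda>x. poly p x * wt a b \<gamma> A B x t) has_integral weight_int a b \<gamma> A B t p) {0..1}"
  unfolding weight_int_def
  by (rule integrable_integral[OF has_integral_integrable[OF has_integral_poly_wt[OF ab]]])

lemma has_integral_weight_cauchy:
  "((\<lambda>x. poly p x * (wt a b \<gamma> A B x t / (x - t))) has_integral weight_cauchy a b \<gamma> A B t p) {0..1}"
  unfolding weight_cauchy_def
  by (rule integrable_integral[OF has_integral_integrable[OF has_integral_poly_wt_cauchy[OF ab]]])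

lemma weight_int_add:
  "weight_int a b \<gamma> A B t (p + q) = weight_int a b \<gamma> A B t p + weight_int a b \<gamma> A B t q"
  using has_integral_add[OF has_integral_weight_int[of p] has_integral_weight_int[of q]]
  unfolding weight_int_def[of _ _ _ _ _ _ "p + q"] by (simp add: integral_unique distrib_right)

lemma weight_int_smult:
  "weight_int a b \<gamma> A B t (smult c p) = c * weight_int a b \<gamma> A B t p"
  unfolding weight_int_def by (simp add: mult.assoc)

lemma weight_cauchy_add:
  "weight_cauchy a b \<gamma> A B t (p + q) = weight_cauchy a b \<gamma> A B t p + weight_cauchy a b \<gamma> A B t q"
  using has_integral_add[OF has_integral_weight_cauchy[of p] has_integral_weight_cauchy[of q]]
  unfolding weight_cauchy_def[of _ _ _ _ _ _ "p + q"]
  by (intro integral_unique) (simp add: distrib_right add_divide_distrib)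

lemma weight_cauchy_smult:
  "weight_cauchy a b \<gamma> A B t (smult c p) = c * weight_cauchy a b \<gamma> A B t p"
  unfolding weight_cauchy_def poly_smult mult.assoc by (rule integral_mult_right)

lemma has_real_derivative_weight_int:
  "((\<lambda>s. weight_int a b \<gamma> A B s p) has_real_derivative - \<gamma> * weight_cauchy a b \<gamma> A B t p) (at t)"
  unfolding weight_int_def weight_cauchy_def by (rule has_real_derivative_integral_poly_wt[OF ab])

lemma weight_cauchy_shift:
  "weight_cauchy a b \<gamma> A B t ([:- t, 1:] * p) = weight_int a b \<gamma> A B t p"
  unfolding weight_int_def weight_cauchy_def
proof (rule integral_cong)
  show "poly ([:- t, 1:] * p) x * (wt a b \<gamma> A B x t / (x - t)) = poly p x * wt a b \<gamma> A B x t" for x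
  proof -
    have "poly ([:- t, 1:] * p) x = (x - t) * poly p x"
      by (simp add: algebra_simps)
    then show ?thesis
      using ab by (cases "x = t") (auto simp: wt_at_singularity)
  qed
qed

end

lemma wt_pred_left: "x \<ge> 0 \<Longrightarrow> x * wt (a - 1) b \<gamma> A B x t = wt a b \<gamma> A B x t"
  by (cases "x = 0") (auto simp: wt_def powr_diff)

lemma wt_pred_right: "x \<le> 1 \<Longrightarrow> (1 - x) * wt a (b - 1) \<gamma> A B x t = wt a b \<gamma> A B x t"
  by (cases "x = 1") (auto simp: wt_def powr_diff)

lemma weight_int_pred_left:
  "weight_int (a - 1) b \<gamma> A B t ([:0, 1:] * p) = weight_int a b \<gamma> A B t p"
  unfolding weight_int_def
proof (rule integral_cong)
  show "poly ([:0, 1:] * p) x * wt (a - 1) b \<gamma> A B x t = poly p x * wt a b \<gamma> A B x t" if "x \<in> {0..1}" for x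
    using that wt_pred_left[of x a b \<gamma> A B t] by (simp add: mult_ac)
qed

lemma weight_int_pred_right:
  "- weight_int a (b - 1) \<gamma> A B t ([:-1, 1:] * p) = weight_int a b \<gamma> A B t p"
  unfolding weight_int_def integral_neg[symmetric]
proof (rule integral_cong)
  show "- (poly ([:-1, 1:] * p) x * wt a (b - 1) \<gamma> A B x t) = poly p x * wt a b \<gamma> A B x t" if "x \<in> {0..1}" for x
    unfolding wt_pred_right[of x a b \<gamma> A B t, symmetric, OF that[unfolded atLeastAtMost_iff, THEN conjunct2]]
    by (simp add: algebra_simps)
qed

text \<open>Partial fractions: 1/(x (x - t)) = (1/(x - t) - 1/x)/t. This turns the t-derivative of
  M_0 into a combination of M_t and M_0.\<close>

lemma weight_cauchy_pred_left:
  assumes "a > 0" "b > -1" "\<gamma> > 0" "0 < t" "t < 1"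
  shows "weight_cauchy (a - 1) b \<gamma> A B t p = (weight_cauchy a b \<gamma> A B t p - weight_int (a - 1) b \<gamma> A B t p) / t"
  unfolding weight_cauchy_def[of "a - 1"]
proof (rule integral_unique)
  have "((\<lambda>x. (poly p x * (wt a b \<gamma> A B x t / (x - t)) - poly p x * wt (a - 1) b \<gamma> A B x t) / t) has_integral
      (weight_cauchy a b \<gamma> A B t p - weight_int (a - 1) b \<gamma> A B t p) / t) {0..1}"
    using assms by (intro has_integral_divide has_integral_diff has_integral_weight_int has_integral_weight_cauchy) auto
  then show "((\<lambda>x. poly p x * (wt (a - 1) b \<gamma> A B x t / (x - t))) has_integral
      (weight_cauchy a b \<gamma> A B t p - weight_int (a - 1) b \<gamma> A B t p) / t) {0..1}"
  proof (rule has_integral_eq[rotated])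
    fix x :: real assume x: "x \<in> {0..1}"
    show "(poly p x * (wt a b \<gamma> A B x t / (x - t)) - poly p x * wt (a - 1) b \<gamma> A B x t) / t
        = poly p x * (wt (a - 1) b \<gamma> A B x t / (x - t))"
    proof (cases "x = t")
      case False
      then show ?thesis
        using x assms unfolding wt_pred_left[of x a b \<gamma> A B t, symmetric, OF x[unfolded atLeastAtMost_iff, THEN conjunct1]]
        by (simp add: divide_simps) (simp add: algebra_simps)
    qed (use assms in \<open>simp add: wt_at_singularity\<close>)
  qed
qed

text \<open>Here 1/((x - 1)(x - t)) = (1/(x - t) - 1/(x - 1))/(t - 1); the signs arise from 1/(x -
  1) = -1/(1 - x).\<close>

lemma weight_cauchy_pred_right:
  assumes "a > -1" "b > 0" "\<gamma> > 0" "0 < t" "t < 1"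
  shows "- weight_cauchy a (b - 1) \<gamma> A B t p = (weight_cauchy a b \<gamma> A B t p + weight_int a (b - 1) \<gamma> A B t p) / (t - 1)"
proof -
  have "((\<lambda>x. (poly p x * (wt a b \<gamma> A B x t / (x - t)) + poly p x * wt a (b - 1) \<gamma> A B x t) / (1 - t)) has_integral
      (weight_cauchy a b \<gamma> A B t p + weight_int a (b - 1) \<gamma> A B t p) / (1 - t)) {0..1}"
    using assms by (intro has_integral_divide has_integral_add has_integral_weight_int has_integral_weight_cauchy) auto
  then have "((\<lambda>x. poly p x * (wt a (b - 1) \<gamma> A B x t / (x - t))) has_integral
      (weight_cauchy a b \<gamma> A B t p + weight_int a (b - 1) \<gamma> A B t p) / (1 - t)) {0..1}"
  proof (rule has_integral_eq[rotated])
    fix x :: real assume x: "x \<in> {0..1}"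
    show "(poly p x * (wt a b \<gamma> A B x t / (x - t)) + poly p x * wt a (b - 1) \<gamma> A B x t) / (1 - t)
        = poly p x * (wt a (b - 1) \<gamma> A B x t / (x - t))"
    proof (cases "x = t")
      case False
      then show ?thesis
        using x assms unfolding wt_pred_right[of x a b \<gamma> A B t, symmetric, OF x[unfolded atLeastAtMost_iff, THEN conjunct2]]
        by (simp add: divide_simps) (simp add: algebra_simps)
    qed (use assms in \<open>simp add: wt_at_singularity\<close>)
  qed
  then have "weight_cauchy a (b - 1) \<gamma> A B t p = (weight_cauchy a b \<gamma> A B t p + weight_int a (b - 1) \<gamma> A B t p) / (1 - t)"
    unfolding weight_cauchy_def[of a "b - 1"] by (rule integral_unique)
  moreover have "- (y / (1 - t)) = y / (t - 1)" for y :: real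
    by (simp add: minus_divide_right)
  ultimately show ?thesis by simp
qed

text \<open>There are no boundary terms because the weight vanishes at 0 and 1. At t continuity is
  enough, and elsewhere w'/w = a/x + b/(x - 1) + \<gamma>/(x - t).\<close>

lemma weight_int_parts:
  assumes "a > 0" "b > 0" "\<gamma> > 0" "0 < t" "t < 1"
  shows "weight_int a b \<gamma> A B t (pderiv p) + a * weight_int (a - 1) b \<gamma> A B t p
    + b * (- weight_int a (b - 1) \<gamma> A B t p) + \<gamma> * weight_cauchy a b \<gamma> A B t p = 0"
proof -
  let ?w = "\<lambda>x. wt a b \<gamma> A B x t"
  let ?F = "\<lambda>x. poly p x * ?w x"
  let ?F' = "\<lambda>x. poly p x * (?w x * (a / x + b / (x - 1) + \<gamma> / (x - t))) + poly (pderiv p) x * ?w x"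
  have "(?F' has_integral (?F 1 - ?F 0)) {0..1}"
  proof (rule fundamental_theorem_of_calculus_interior_strong[of "{t}"])
    show "(?F has_vector_derivative ?F' x) (at x)" if "x \<in> {0<..<1} - {t}" for x
      unfolding has_real_derivative_iff_has_vector_derivative[symmetric]
      using that by (intro DERIV_mult' poly_DERIV has_real_derivative_wt) auto
    show "continuous_on {0..1} ?F"
      using assms by (intro continuous_on_mult continuous_on_wt continuous_on_poly continuous_on_id) auto
  qed auto
  then have int: "(?F' has_integral 0) {0..1}"
    by (simp add: wt_def)
  have "((\<lambda>x. poly (pderiv p) x * ?w x + a * (poly p x * wt (a - 1) b \<gamma> A B x t)
      + b * - (poly p x * wt a (b - 1) \<gamma> A B x t) + \<gamma> * (poly p x * (?w x / (x - t)))) has_integral 0) {0..1}"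
  proof (rule has_integral_spike_finite[where S = "{0, 1, t}", OF _ _ int])
    fix x assume x: "x \<in> {0..1} - {0, 1, t}"
    have 1: "wt (a - 1) b \<gamma> A B x t = ?w x / x"
      using x wt_pred_left[of x a b \<gamma> A B t] by (simp add: field_simps)
    have 2: "- wt a (b - 1) \<gamma> A B x t = ?w x / (x - 1)"
      using x wt_pred_right[of x a b \<gamma> A B t] by (simp add: field_simps)
    have "- (poly p x * wt a (b - 1) \<gamma> A B x t) = poly p x * (?w x / (x - 1))"
      unfolding 2[symmetric] by simp
    then show "poly (pderiv p) x * ?w x + a * (poly p x * wt (a - 1) b \<gamma> A B x t)
      + b * - (poly p x * wt a (b - 1) \<gamma> A B x t) + \<gamma> * (poly p x * (?w x / (x - t))) = ?F' x"
      unfolding 1 by (simp add: algebra_simps)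
  qed auto
  moreover have "((\<lambda>x. poly (pderiv p) x * ?w x + a * (poly p x * wt (a - 1) b \<gamma> A B x t)
      + b * - (poly p x * wt a (b - 1) \<gamma> A B x t) + \<gamma> * (poly p x * (?w x / (x - t)))) has_integral
      weight_int a b \<gamma> A B t (pderiv p) + a * weight_int (a - 1) b \<gamma> A B t p
      + b * (- weight_int a (b - 1) \<gamma> A B t p) + \<gamma> * weight_cauchy a b \<gamma> A B t p) {0..1}"
    using assms
    by (intro has_integral_add has_integral_mult_right has_integral_neg has_integral_weight_int
          has_integral_weight_cauchy) auto
  ultimately show ?thesis
    by (rule has_integral_unique[symmetric])
qed

text \<open>The integrand is continuous and nonnegative, so a vanishing integral would force it to
  be 0 everywhere and give p infinitely many roots.\<close>

lemma weight_int_pos: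
  assumes "a > 0" "b > 0" "\<gamma> > 0" "0 < t" "t < 1"
    and "A \<ge> 0" "A + B \<ge> 0" "\<not> (A = 0 \<and> A + B = 0)" "p \<noteq> 0"
  shows "weight_int a b \<gamma> A B t (p * p) > 0"
proof -
  let ?f = "\<lambda>x. poly (p * p) x * wt a b \<gamma> A B x t"
  have int: "(?f has_integral weight_int a b \<gamma> A B t (p * p)) {0..1}"
    using assms by (intro has_integral_weight_int) auto
  have nonneg: "?f x \<ge> 0" for x
    using assms by (auto simp: wt_def heaviside_def)
  have "weight_int a b \<gamma> A B t (p * p) \<noteq> 0"
  proof
    assume "weight_int a b \<gamma> A B t (p * p) = 0"
    moreover have "continuous_on {0..1} ?f"
      using assms by (intro continuous_on_mult continuous_on_wt continuous_on_poly continuous_on_id) auto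
    ultimately have 0: "?f x = 0" if "x \<in> {0..1}" for x
      using has_integral_0_cbox_imp_0[of 0 1 ?f x] int nonneg that by simp
    \<comment> \<open>One side of t suffices: the weight is positive on (t, 1) if A = 0, and on (0,
      t) otherwise.\<close>
    obtain S where S: "infinite S" "S \<subseteq> {0<..<1}" "\<And>x. x \<in> S \<Longrightarrow> wt a b \<gamma> A B x t \<noteq> 0"
    proof (cases "A = 0")
      case True
      show ?thesis
        using assms True by (intro that[of "{t<..<1}"]) (auto simp: wt_def heaviside_def)
    next
      case False
      show ?thesis
        using assms False by (intro that[of "{0<..<t}"]) (auto simp: wt_def heaviside_def)
    qed
    have "poly p x = 0" if "x \<in> S" for x
      using 0[of x] S(2,3) that by force
    then have "S \<subseteq> {x. poly p x = 0}"
      by auto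
    then show False
      using poly_roots_finite[OF \<open>p \<noteq> 0\<close>] S(1) finite_subset by blast
  qed
  moreover have "weight_int a b \<gamma> A B t (p * p) \<ge> 0"
    using has_integral_nonneg[OF int] nonneg by simp
  ultimately show ?thesis by simp
qed

section \<open>Orthogonal polynomials of a positive functional\<close>

text \<open>Degree less than \<open>n\<close>; unlike \<open>degree f < n\<close> this makes sense for \<open>n = 0\<close> and the zero polynomial.\<close>

definition below :: "nat \<Rightarrow> real poly \<Rightarrow> bool" where
  "below n f \<longleftrightarrow> (\<forall>i\<ge>n. coeff f i = 0)"

lemma below_0 [simp]: "below 0 f \<longleftrightarrow> f = 0"
  by (auto simp: below_def poly_eq_iff)

lemma below_zero [simp]: "below n 0"
  by (simp add: below_def)

lemma below_mono: "below m f \<Longrightarrow> m \<le> n \<Longrightarrow> below n f"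
  by (auto simp: below_def)

lemma below_Suc_reduce: "below (Suc n) f \<Longrightarrow> coeff f n = 0 \<Longrightarrow> below n f"
  unfolding below_def by (metis not_less_eq_eq le_antisym)

lemma below_diff: "below n f \<Longrightarrow> below n g \<Longrightarrow> below n (f - g)"
  and below_smult: "below n f \<Longrightarrow> below n (smult c f)"
  and below_pderiv: "below (Suc n) f \<Longrightarrow> below n (pderiv f)"
  and below_monom: "m < n \<Longrightarrow> below n (monom c m)"
  by (auto simp: below_def coeff_pderiv coeff_monom)

lemma below_sum: "(\<And>i. i \<in> I \<Longrightarrow> below n (f i)) \<Longrightarrow> below n (sum f I)"
  by (auto simp: below_def coeff_sum)

lemma below_degree: "below n f \<longleftrightarrow> f = 0 \<or> degree f < n"
  unfolding below_def by (metis coeff_0 coeff_eq_0 leading_coeff_0_iff linorder_not_le order_less_le_trans)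

lemma below_mult: "below (Suc m) f \<Longrightarrow> below n g \<Longrightarrow> below (m + n) (f * g)"
  using degree_mult_le[of f g] by (auto simp: below_degree)

lemma below_linear_mult: "below n f \<Longrightarrow> below (Suc n) ([:a, b:] * f)"
  using below_mult[of 1 "[:a, b:]" n f] by (simp add: below_def coeff_pCons split: nat.splits)

lemma below_eq_sum_monom: "below n f \<Longrightarrow> f = (\<Sum>i<n. monom (coeff f i) i)"
  by (rule poly_eqI) (auto simp: coeff_sum coeff_monom below_def if_distrib cong: if_cong)

definition poly_linear :: "(real poly \<Rightarrow> real) \<Rightarrow> bool" where
  "poly_linear \<Lambda> \<longleftrightarrow> (\<forall>p q. \<Lambda> (p + q) = \<Lambda> p + \<Lambda> q) \<and> (\<forall>c p. \<Lambda> (smult c p) = c * \<Lambda> p)"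

context
  fixes \<Lambda> assumes lin: "poly_linear \<Lambda>"
begin

lemma poly_linear_add: "\<Lambda> (p + q) = \<Lambda> p + \<Lambda> q"
  and poly_linear_smult: "\<Lambda> (smult c p) = c * \<Lambda> p"
  using lin by (auto simp: poly_linear_def)

lemma poly_linear_zero: "\<Lambda> 0 = 0"
  using poly_linear_smult[of 0 0] by simp

lemma poly_linear_uminus: "\<Lambda> (- p) = - \<Lambda> p"
  using poly_linear_smult[of "-1" p] by simp

lemma poly_linear_diff: "\<Lambda> (p - q) = \<Lambda> p - \<Lambda> q"
  using poly_linear_add[of p "- q"] poly_linear_uminus[of q] by simp

lemma poly_linear_sum: "\<Lambda> (\<Sum>i\<in>I. f i) = (\<Sum>i\<in>I. \<Lambda> (f i))"
  by (induction I rule: infinite_finite_induct) (auto simp: poly_linear_add poly_linear_zero)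

lemma poly_linear_eq_sum:
  assumes "below n f"
  shows "\<Lambda> f = (\<Sum>i<n. coeff f i * \<Lambda> (monom 1 i))"
proof -
  have "\<Lambda> f = (\<Sum>i<n. \<Lambda> (monom (coeff f i) i))"
    by (subst below_eq_sum_monom[OF assms]) (rule poly_linear_sum)
  also have "\<dots> = (\<Sum>i<n. coeff f i * \<Lambda> (monom 1 i))"
    by (intro sum.cong refl) (simp flip: poly_linear_smult add: smult_monom)
  finally show ?thesis .
qed

end

declare sum.cong [fundef_cong]

text \<open>Gram-Schmidt applied to the monomials. The congruence rule declared above supplies k < n
  for the recursive calls under the sum, as termination requires.\<close>

fun orth_poly :: "(real poly \<Rightarrow> real) \<Rightarrow> nat \<Rightarrow> real poly" where
  "orth_poly L n = monom 1 n -
     (\<Sum>k<n. smult (L (monom 1 n * orth_poly L k) / L (orth_poly L k * orth_poly L k)) (orth_poly L k))"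

declare orth_poly.simps [simp del]

definition orth_norm :: "(real poly \<Rightarrow> real) \<Rightarrow> nat \<Rightarrow> real" where
  "orth_norm L n = L (orth_poly L n * orth_poly L n)"

text \<open>The Christoffel-Darboux kernel K_n(x, y), as a polynomial in x for a fixed real
  y.\<close>

definition cd_kernel :: "(real poly \<Rightarrow> real) \<Rightarrow> nat \<Rightarrow> real \<Rightarrow> real poly" where
  "cd_kernel L n y = (\<Sum>j<n. smult (poly (orth_poly L j) y / orth_norm L j) (orth_poly L j))"

definition subleading :: "(real poly \<Rightarrow> real) \<Rightarrow> nat \<Rightarrow> real" where
  "subleading L n = (if n = 0 then 0 else coeff (orth_poly L n) (n - 1))"

lemma subleading_Suc: "subleading L (Suc n) = coeff (orth_poly L (Suc n)) n"
  by (simp add: subleading_def)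

lemma cd_kernel_Suc:
  "cd_kernel L (Suc n) y = cd_kernel L n y + smult (poly (orth_poly L n) y / orth_norm L n) (orth_poly L n)"
  by (simp add: cd_kernel_def)

locale positive_functional =
  fixes L :: "real poly \<Rightarrow> real"
  assumes linear: "poly_linear L"
    and pos: "p \<noteq> 0 \<Longrightarrow> L (p * p) > 0"
begin

lemmas L_add = poly_linear_add[OF linear] and L_smult = poly_linear_smult[OF linear]
  and L_zero = poly_linear_zero[OF linear] and L_diff = poly_linear_diff[OF linear]
  and L_sum = poly_linear_sum[OF linear]

abbreviation "P \<equiv> orth_poly L"
abbreviation "h \<equiv> orth_norm L"
lemmas h_def = orth_norm_def[of L]

lemma below_orth_poly: "below (Suc n) (P n)"
  and coeff_orth_poly: "coeff (P n) n = 1"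
proof -
  have "below (Suc n) (P n) \<and> coeff (P n) n = 1"
  proof (induction n rule: less_induct)
    case (less n)
    let ?S = "\<Sum>k<n. smult (L (monom 1 n * P k) / L (P k * P k)) (P k)"
    have "below n (P k)" if "k < n" for k
      using less[OF that] that below_mono[of "Suc k" "P k" n] by simp
    then have "below n ?S"
      by (intro below_sum below_smult) simp
    then show ?case
      by (subst (1 2) orth_poly.simps) (auto simp: below_def coeff_monom)
  qed
  then show "below (Suc n) (P n)" "coeff (P n) n = 1"
    by auto
qed

lemma orth_poly_nonzero: "P n \<noteq> 0"
  using coeff_orth_poly[of n] by auto

lemma h_pos: "h n > 0"
  unfolding h_def by (intro pos orth_poly_nonzero)

lemma h_nonzero: "h n \<noteq> 0"
  using h_pos[of n] by simp

lemma orth_poly_0: "P 0 = 1"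
  by (subst orth_poly.simps) simp

lemma orth_poly_orthogonal: "m < n \<Longrightarrow> L (P n * P m) = 0"
proof (induction n arbitrary: m rule: less_induct)
  case (less n)
  have 1: "L (P k * P m) = 0" if "k < n" "k \<noteq> m" for k
    using less.IH[of k m] less.IH[of m k] that less.prems by (cases "m < k") (auto simp: mult.commute)
  have "L (P n * P m) = L (monom 1 n * P m) - (\<Sum>k<n. L (monom 1 n * P k) / L (P k * P k) * L (P k * P m))"
    by (subst orth_poly.simps) (simp add: left_diff_distrib sum_distrib_right L_diff L_sum L_smult)
  also have "(\<Sum>k<n. L (monom 1 n * P k) / L (P k * P k) * L (P k * P m))
      = (\<Sum>k<n. if k = m then L (monom 1 n * P m) else 0)"
    using 1 h_nonzero[of m] by (intro sum.cong) (auto simp: h_def)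
  finally show ?case
    using less.prems by simp
qed

lemma below_reduce:
  assumes "below (Suc n) f"
  shows "below n (f - smult (coeff f n) (P n))"
proof (rule below_Suc_reduce)
  show "below (Suc n) (f - smult (coeff f n) (P n))"
    using assms below_orth_poly by (intro below_diff below_smult)
qed (simp add: coeff_orth_poly)

lemma orth_poly_below:
  assumes "below n f"
  shows "L (P n * f) = 0"
proof -
  have "L (P n * f) = 0" if "m \<le> n" "below m f" for m f
    using that
  proof (induction m arbitrary: f)
    case (Suc m)
    have "L (P n * (f - smult (coeff f m) (P m))) = 0"
      using Suc below_reduce by simp
    then show ?case
      using Suc.prems orth_poly_orthogonal[of m n] by (simp add: right_diff_distrib L_diff L_smult)
  qed (simp add: L_zero)
  then show ?thesis
    using assms by blast
qed

lemma orth_poly_below_Suc: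
  assumes "below (Suc n) f"
  shows "L (P n * f) = coeff f n * h n"
  using orth_poly_below[OF below_reduce[OF assms]]
  by (simp add: right_diff_distrib L_diff L_smult h_def)

lemma eq_zero_if_orthogonal:
  assumes "below n f" "\<And>g. below n g \<Longrightarrow> L (f * g) = 0"
  shows "f = 0"
  using assms(2)[OF assms(1)] pos[of f] by force

lemma below_cd_kernel: "below n (cd_kernel L n y)"
  unfolding cd_kernel_def by (intro below_sum below_smult) (auto intro: below_mono[OF below_orth_poly])

lemma cd_kernel_orth_poly: "L (cd_kernel L n y * P n) = 0"
  using orth_poly_below[OF below_cd_kernel] by (simp add: mult.commute)

lemma cd_kernel_reproducing: "below n f \<Longrightarrow> L (cd_kernel L n y * f) = poly f y"
proof (induction n arbitrary: f)
  case (Suc n)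
  let ?g = "f - smult (coeff f n) (P n)"
  have g: "L (cd_kernel L n y * ?g) = poly ?g y"
    using Suc below_reduce by blast
  have "L (cd_kernel L n y * f) = poly ?g y"
    using g by (simp add: right_diff_distrib L_diff L_smult cd_kernel_orth_poly)
  moreover have "L (P n * f) = coeff f n * h n"
    by (rule orth_poly_below_Suc[OF Suc.prems])
  ultimately show ?case
    using h_nonzero[of n] by (simp add: cd_kernel_Suc distrib_right L_add L_smult)
qed (simp add: L_zero)

text \<open>No three-term recurrence is used. The difference \<open>D\<close> of the two sides has
  degree at most m, since the coefficients of x^(m + 1) cancel, and it is orthogonal to everything
  of degree at most m; positivity then forces \<open>D = 0\<close>.\<close>

lemma christoffel_darboux:
  "[:- y, 1:] * cd_kernel L (Suc m) y =
     smult (poly (P m) y / h m) (P (Suc m)) - smult (poly (P (Suc m)) y / h m) (P m)"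
proof -
  let ?K = "cd_kernel L (Suc m) y"
  define D where "D = [:- y, 1:] * ?K -
     (smult (poly (P m) y / h m) (P (Suc m)) - smult (poly (P (Suc m)) y / h m) (P m))"
  have K: "below (Suc m) ?K" "coeff ?K m = poly (P m) y / h m"
    using below_cd_kernel[of m y] below_cd_kernel[of "Suc m" y] by (auto simp: cd_kernel_Suc coeff_orth_poly below_def)
  have "below (Suc m) D"
  proof (rule below_Suc_reduce)
    show "below (Suc (Suc m)) D"
      unfolding D_def
      by (intro below_diff below_smult below_linear_mult below_orth_poly below_cd_kernel
            below_mono[OF below_orth_poly[of m]]) auto
    show "coeff D (Suc m) = 0"
      using K below_orth_poly[of m] by (simp add: D_def coeff_orth_poly below_def)
  qed
  moreover have "L (D * f) = 0" if f: "below (Suc m) f" for f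
  proof -
    define g where "g = f - smult (coeff f m) (P m)"
    have g: "below m g" and f_eq: "f = smult (coeff f m) (P m) + g"
      using below_reduce[OF f] by (auto simp: g_def)
    \<comment> \<open>The product (x - y) g still has degree at most m, so the reproducing property
      returns its value at y.\<close>
    have "L (?K * ([:- y, 1:] * g)) = 0"
      using cd_kernel_reproducing[OF below_linear_mult[OF g], of y "- y" 1] by simp
    moreover have "L (P (Suc m) * g) = 0" "L (P m * g) = 0"
      using g below_mono by (auto intro!: orth_poly_below)
    ultimately have Dg: "L (D * g) = 0"
      by (simp add: D_def left_diff_distrib L_diff L_smult mult.assoc mult.left_commute[of "[:- y, 1:]"]
            del: mult_pCons_left mult_pCons_right)
    \<comment> \<open>(x - y) P_m has one degree too many for the reproducing property; subtracting
      P_(m + 1), which the kernel annihilates, brings it down.\<close>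
    let ?e = "[:- y, 1:] * P m - P (Suc m)"
    have "below (Suc m) ?e"
    proof (rule below_Suc_reduce)
      show "below (Suc (Suc m)) ?e"
        by (intro below_diff below_linear_mult below_orth_poly)
      show "coeff ?e (Suc m) = 0"
        using below_orth_poly[of m] by (simp add: coeff_orth_poly below_def)
    qed
    from cd_kernel_reproducing[OF this, of y] have "L (?K * ?e) = - poly (P (Suc m)) y"
      by simp
    then have "L (?K * ([:- y, 1:] * P m)) = - poly (P (Suc m)) y"
      by (simp add: right_diff_distrib L_diff cd_kernel_orth_poly del: mult_pCons_left mult_pCons_right)
    then have DP: "L (D * P m) = 0"
      using orth_poly_orthogonal[of m "Suc m"] h_nonzero[of m]
      by (simp add: D_def left_diff_distrib L_diff L_smult mult.assoc mult.left_commute[of "[:- y, 1:]"]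
             h_def[symmetric] del: mult_pCons_left mult_pCons_right)
    show ?thesis
      by (subst f_eq) (simp add: distrib_left L_add L_smult Dg DP)
  qed
  ultimately have "D = 0"
    by (rule eq_zero_if_orthogonal)
  then show ?thesis
    by (simp add: D_def)
qed

end

text \<open>\<open>M p\<close> plays the role of \<open>L (p / (x - a))\<close>, and \<open>M (P n)\<close> that of the function of the second
  kind at \<open>a\<close>.\<close>

locale cauchy_functional = positive_functional +
  fixes M :: "real poly \<Rightarrow> real" and a :: real
  assumes M_linear: "poly_linear M"
    and M_shift: "M ([:- a, 1:] * p) = L p"
begin

lemmas M_add = poly_linear_add[OF M_linear] and M_smult = poly_linear_smult[OF M_linear]

text \<open>Write f = (x - a) q + f(a). Then M(P_n f) = L(P_n q) + f(a) M(P_n), and L(P_n q) sees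
  only the coefficient of x^n in q, which is that of x^(n + 1) in f.\<close>

lemma orth_poly_cauchy:
  assumes "below (Suc (Suc n)) f"
  shows "M (P n * f) = poly f a * M (P n) + coeff f (Suc n) * h n"
proof -
  define q where "q = synthetic_div f a"
  have f: "f = [:- a, 1:] * q + [:poly f a:]"
    by (simp add: q_def synthetic_div_correct' del: mult_pCons_left)
  have c: "coeff f (Suc i) = coeff q i - a * coeff q (Suc i)" for i
    by (subst f) simp
  have q: "below (Suc n) q"
  proof (cases "q = 0")
    case False
    then have "coeff f (Suc (degree q)) \<noteq> 0"
      unfolding c by (simp add: coeff_eq_0)
    then have "Suc (degree q) < Suc (Suc n)"
      using assms by (meson below_def not_le)
    then show ?thesis
      by (simp add: below_degree)
  qed simp
  have "P n * f = [:- a, 1:] * (P n * q) + smult (poly f a) (P n)"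
    by (subst f) (simp add: algebra_simps)
  then have "M (P n * f) = L (P n * q) + poly f a * M (P n)"
    by (simp add: M_add M_smult M_shift del: mult_pCons_left)
  moreover have "coeff f (Suc n) = coeff q n"
    using q by (simp add: c below_def)
  ultimately show ?thesis
    using orth_poly_below_Suc[OF q] by simp
qed

lemma orth_poly_cauchy_below:
  assumes "below (Suc n) f"
  shows "M (P n * f) = poly f a * M (P n)"
proof -
  have "coeff f (Suc n) = 0"
    using assms by (simp add: below_def)
  then show ?thesis
    using orth_poly_cauchy[OF below_mono[OF assms]] by simp
qed

lemma cauchy_diag: "M (P n * P n) = poly (P n) a * M (P n)"
  by (intro orth_poly_cauchy_below below_orth_poly)

lemma cauchy_off_diag: "M (P (Suc n) * P n) = poly (P n) a * M (P (Suc n))"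
  by (intro orth_poly_cauchy_below below_mono[OF below_orth_poly]) simp

text \<open>M(P_n P_(n + 1)) is evaluated in two ways, with either factor in the role of f. Only f =
  P_(n + 1) has a degree high enough to produce h_n.\<close>

lemma cauchy_casorati: "poly (P n) a * M (P (Suc n)) = poly (P (Suc n)) a * M (P n) + h n"
  using orth_poly_cauchy[OF below_orth_poly, of n] cauchy_off_diag[of n]
  by (simp add: mult.commute coeff_orth_poly)

end

section \<open>Deformation of the functional\<close>

text \<open>Differentiation coefficient by coefficient. The uniform degree bound needed to apply
  functionals is carried separately, by \<open>below\<close>.\<close>

definition has_poly_derivative :: "(real \<Rightarrow> real poly) \<Rightarrow> real poly \<Rightarrow> real \<Rightarrow> bool" where
  "has_poly_derivative F F' t \<longleftrightarrow> (\<forall>i. ((\<lambda>s. coeff (F s) i) has_real_derivative coeff F' i) (at t))"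

lemma has_poly_derivative_const: "has_poly_derivative (\<lambda>_. p) 0 t"
  by (simp add: has_poly_derivative_def)

lemma has_poly_derivative_diff:
  "has_poly_derivative F F' t \<Longrightarrow> has_poly_derivative G G' t \<Longrightarrow>
    has_poly_derivative (\<lambda>s. F s - G s) (F' - G') t"
  by (auto simp: has_poly_derivative_def intro!: DERIV_diff)

lemma has_poly_derivative_sum:
  "(\<And>k. k \<in> I \<Longrightarrow> has_poly_derivative (F k) (F' k) t) \<Longrightarrow>
    has_poly_derivative (\<lambda>s. \<Sum>k\<in>I. F k s) (\<Sum>k\<in>I. F' k) t"
  by (auto simp: has_poly_derivative_def coeff_sum intro!: DERIV_sum)

lemma has_poly_derivative_smult:
  assumes "(c has_real_derivative c') (at t)" "has_poly_derivative F F' t"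
  shows "has_poly_derivative (\<lambda>s. smult (c s) (F s)) (smult c' (F t) + smult (c t) F') t"
  unfolding has_poly_derivative_def
proof
  fix i
  have "((\<lambda>s. c s * coeff (F s) i) has_real_derivative c t * coeff F' i + c' * coeff (F t) i) (at t)"
    using assms unfolding has_poly_derivative_def by (intro DERIV_mult') auto
  then show "((\<lambda>s. coeff (smult (c s) (F s)) i) has_real_derivative
      coeff (smult c' (F t) + smult (c t) F') i) (at t)"
    by (simp add: add.commute)
qed

lemma has_poly_derivative_mult:
  assumes "has_poly_derivative F F' t" "has_poly_derivative G G' t"
  shows "has_poly_derivative (\<lambda>s. F s * G s) (F' * G t + F t * G') t"
  unfolding has_poly_derivative_def
proof
  fix i
  have "((\<lambda>s. \<Sum>j\<le>i. coeff (F s) j * coeff (G s) (i - j)) has_real_derivative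
      (\<Sum>j\<le>i. coeff F' j * coeff (G t) (i - j) + coeff G' (i - j) * coeff (F t) j)) (at t)"
    using assms unfolding has_poly_derivative_def by (intro DERIV_sum DERIV_mult) auto
  then show "((\<lambda>s. coeff (F s * G s) i) has_real_derivative coeff (F' * G t + F t * G') i) (at t)"
    by (simp add: coeff_mult sum.distrib mult.commute[of "coeff (F t) _"])
qed

text \<open>Constants \<open>c i\<close> other than 0 are allowed so that the fixed leading
  coefficient 1 of P_n counts too: the derivative of P_n then has degree below n.\<close>

lemma below_poly_derivative:
  assumes "has_poly_derivative F F' t" "open S" "t \<in> S"
    and "\<And>i s. i \<ge> N \<Longrightarrow> s \<in> S \<Longrightarrow> coeff (F s) i = c i"
  shows "below N F'"
  unfolding below_def
proof (intro allI impI)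
  fix i assume i: "i \<ge> N"
  have "((\<lambda>_. c i) has_real_derivative 0) (at t)"
    by simp
  then have "((\<lambda>s. coeff (F s) i) has_real_derivative 0) (at t)"
    by (rule has_field_derivative_transform_within_open[OF _ assms(2,3)]) (simp add: assms i)
  moreover have "((\<lambda>s. coeff (F s) i) has_real_derivative coeff F' i) (at t)"
    using assms(1) by (simp add: has_poly_derivative_def)
  ultimately show "coeff F' i = 0"
    by (rule DERIV_unique[symmetric])
qed

text \<open>The product rule when both functional and argument move. The common bound N makes it a
  finite sum over moments.\<close>

lemma has_real_derivative_functional:
  fixes \<Lambda> :: "real \<Rightarrow> real poly \<Rightarrow> real"
  assumes S: "open S" "t \<in> S"
    and \<Lambda>: "\<And>s. s \<in> S \<Longrightarrow> poly_linear (\<Lambda> s)" and \<Lambda>': "poly_linear \<Lambda>'"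
    and deriv: "\<And>p. ((\<lambda>s. \<Lambda> s p) has_real_derivative \<Lambda>' p) (at t)"
    and F: "has_poly_derivative F F' t" "\<And>s. s \<in> S \<Longrightarrow> below N (F s)"
  shows "((\<lambda>s. \<Lambda> s (F s)) has_real_derivative \<Lambda> t F' + \<Lambda>' (F t)) (at t)"
proof -
  have "below N F'"
    by (rule below_poly_derivative[OF F(1) S, where c = "\<lambda>_. 0"]) (use F(2) in \<open>auto simp: below_def\<close>)
  have "((\<lambda>s. \<Sum>i<N. coeff (F s) i * \<Lambda> s (monom 1 i)) has_real_derivative
      (\<Sum>i<N. coeff F' i * \<Lambda> t (monom 1 i) + \<Lambda>' (monom 1 i) * coeff (F t) i)) (at t)"
    using F(1) unfolding has_poly_derivative_def by (intro DERIV_sum DERIV_mult deriv) auto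
  moreover have "(\<Sum>i<N. coeff F' i * \<Lambda> t (monom 1 i) + \<Lambda>' (monom 1 i) * coeff (F t) i) = \<Lambda> t F' + \<Lambda>' (F t)"
    using poly_linear_eq_sum[OF \<Lambda>[OF S(2)] \<open>below N F'\<close>] poly_linear_eq_sum[OF \<Lambda>' F(2)[OF S(2)]]
    by (simp add: sum.distrib mult.commute)
  ultimately have "((\<lambda>s. \<Sum>i<N. coeff (F s) i * \<Lambda> s (monom 1 i)) has_real_derivative
      \<Lambda> t F' + \<Lambda>' (F t)) (at t)"
    by simp
  then show ?thesis
    by (rule has_field_derivative_transform_within_open[OF _ S]) (simp add: poly_linear_eq_sum[OF \<Lambda> F(2)])
qed

text \<open>The algebra behind the Schlesinger equation. Here p, r are the values of P_(m + 1), P_m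
  at t, and q, s the corresponding functions of the second kind; p0, r0, q0, s0 are the same at a.
  Further H = h_m, d = t - a, and X = K_(m + 1)(a, t).\<close>

lemma off_diag_identity:
  fixes H d p q r s p0 q0 r0 s0 \<gamma> :: real
  assumes "H \<noteq> 0" "d \<noteq> 0" "r * q = p * s + H" "r0 * q0 = p0 * s0 + H"
    and "X = (p * r0 - r * p0) / (H * d)"
  shows "(((\<gamma> * q * (X * s0) + \<gamma> * s * ((X - r * r0 / H) * q0)) + - \<gamma> * (r * q - r0 * q0) / d) * H
      - (r0 * q0) * (- \<gamma> * (r * s))) / (H * H) = \<gamma> / (d * H\<^sup>2) * ((p * q) * (r0 * s0) - (p0 * q0) * (r * s))"
proof -
  have "(((\<gamma> * q * (X * s0) + \<gamma> * s * ((X - r * r0 / H) * q0)) + - \<gamma> * (r * q - r0 * q0) / d) * H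
      - (r0 * q0) * (- \<gamma> * (r * s))) / (H * H)
      = \<gamma> / (d * H\<^sup>2) * ((q * s0 + s * q0) * (p * r0 - r * p0) - (r * q * H - r0 * q0 * H))"
    using assms(1,2) unfolding assms(5) by (simp add: divide_simps power2_eq_square) (simp add: algebra_simps)
  \<comment> \<open>In each product H is replaced by means of the Casorati relation at the other
    point.\<close>
  also have "r * q * H - r0 * q0 * H = r * q * (r0 * q0 - p0 * s0) - r0 * q0 * (r * q - p * s)"
    using assms(3,4) by simp
  also have "(q * s0 + s * q0) * (p * r0 - r * p0) - \<dots> = (p * q) * (r0 * s0) - (p0 * q0) * (r * s)"
    by (simp add: algebra_simps)
  finally show ?thesis .
qed

locale deformed_functional =
  fixes L Mt :: "real \<Rightarrow> real poly \<Rightarrow> real" and \<gamma> :: real and S :: "real set"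
  assumes open_S: "open S"
    and functional: "t \<in> S \<Longrightarrow> cauchy_functional (L t) (Mt t) t"
    and deriv_L: "t \<in> S \<Longrightarrow> ((\<lambda>s. L s p) has_real_derivative - \<gamma> * Mt t p) (at t)"
begin

abbreviation "\<pi> t \<equiv> orth_poly (L t)"
abbreviation "\<eta> t \<equiv> orth_norm (L t)"
abbreviation "\<kappa> t \<equiv> cd_kernel (L t)"

lemma positive: "t \<in> S \<Longrightarrow> positive_functional (L t)"
  using functional cauchy_functional.axioms(1) by blast

lemma linear_L: "t \<in> S \<Longrightarrow> poly_linear (L t)"
  using positive positive_functional.linear by blast

lemma linear_Mt: "t \<in> S \<Longrightarrow> poly_linear (Mt t)"
  using functional cauchy_functional.M_linear by blast

lemma linear_deriv: "t \<in> S \<Longrightarrow> poly_linear (\<lambda>p. - \<gamma> * Mt t p)"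
  using linear_Mt[of t] by (simp add: poly_linear_def algebra_simps)

lemma below_P: "t \<in> S \<Longrightarrow> n < N \<Longrightarrow> below N (\<pi> t n)"
  by (rule below_mono[OF positive_functional.below_orth_poly[OF positive] Suc_leI])

lemma has_real_derivative_L:
  assumes "t \<in> S" "has_poly_derivative F F' t" "\<And>s. s \<in> S \<Longrightarrow> below N (F s)"
  shows "((\<lambda>s. L s (F s)) has_real_derivative L t F' - \<gamma> * Mt t (F t)) (at t)"
  using has_real_derivative_functional[OF open_S assms(1) linear_L linear_deriv deriv_L assms(2,3)] assms(1)
  by simp

text \<open>Only existence is drawn from the Gram-Schmidt recursion; the value is found afterwards
  from orthogonality.\<close>

lemma ex_poly_derivative_orth_poly:
  assumes t: "t \<in> S"
  shows "\<exists>P'. has_poly_derivative (\<lambda>s. \<pi> s n) P' t"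
proof (induction n rule: less_induct)
  case (less n)
  then obtain D where D: "\<And>k. k < n \<Longrightarrow> has_poly_derivative (\<lambda>s. \<pi> s k) (D k) t"
    by metis
  let ?c = "\<lambda>k s. L s (monom 1 n * \<pi> s k) / L s (\<pi> s k * \<pi> s k)"
  have "\<exists>c'. ((?c k) has_real_derivative c') (at t)" if k: "k < n" for k
  proof -
    have "L t (\<pi> t k * \<pi> t k) \<noteq> 0"
      using positive_functional.h_nonzero[OF positive[OF t]] by (simp add: orth_norm_def)
    moreover have "\<And>s. s \<in> S \<Longrightarrow> below (n + n) (monom 1 n * \<pi> s k)"
      using below_P k by (intro below_mult below_monom) auto
    moreover have "\<And>s. s \<in> S \<Longrightarrow> below (n + n) (\<pi> s k * \<pi> s k)"
      using below_P k by (intro below_mult) auto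
    ultimately show ?thesis
      using has_real_derivative_L[OF t has_poly_derivative_mult[OF has_poly_derivative_const D[OF k]]]
        has_real_derivative_L[OF t has_poly_derivative_mult[OF D[OF k] D[OF k]]]
        DERIV_divide by blast
  qed
  then have "\<forall>k\<in>{..<n}. \<exists>c'. ((?c k) has_real_derivative c') (at t)"
    by blast
  from bchoice[OF this] obtain c' where c': "\<And>k. k < n \<Longrightarrow> ((?c k) has_real_derivative c' k) (at t)"
    by auto
  have "has_poly_derivative (\<lambda>s. monom 1 n - (\<Sum>k<n. smult (?c k s) (\<pi> s k)))
      (0 - (\<Sum>k<n. smult (c' k) (\<pi> t k) + smult (?c k t) (D k))) t"
    using c' D
    by (intro has_poly_derivative_diff has_poly_derivative_const has_poly_derivative_sum
        has_poly_derivative_smult) auto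
  then show ?case
    by (subst orth_poly.simps) blast
qed

text \<open>Differentiating L(P_n g) = 0 for fixed g of degree below n gives L(P_n' g) = \<gamma>
  M_t(P_n g) = \<gamma> g(t) M_t(P_n). The kernel is the polynomial of degree below n that
  represents evaluation at t.\<close>

lemma has_poly_derivative_orth_poly:
  assumes t: "t \<in> S"
  shows "has_poly_derivative (\<lambda>s. \<pi> s n) (smult (\<gamma> * Mt t (\<pi> t n)) (\<kappa> t n t)) t"
proof -
  interpret cauchy_functional "L t" "Mt t" t
    using functional[OF t] .
  obtain P' where P': "has_poly_derivative (\<lambda>s. \<pi> s n) P' t"
    using ex_poly_derivative_orth_poly[OF t] by blast
  have coeff: "coeff (\<pi> s n) i = (if i = n then 1 else 0)" if "i \<ge> n" "s \<in> S" for s i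
    using positive_functional.below_orth_poly[OF positive[OF that(2)], of n] that(1)
      positive_functional.coeff_orth_poly[OF positive[OF that(2)], of n]
    by (auto simp: below_def)
  have below: "below n P'"
    by (rule below_poly_derivative[OF P' open_S t coeff])
  have "P' - smult (\<gamma> * Mt t (\<pi> t n)) (\<kappa> t n t) = 0"
  proof (rule eq_zero_if_orthogonal)
    show "below n (P' - smult (\<gamma> * Mt t (\<pi> t n)) (\<kappa> t n t))"
      by (intro below_diff below below_smult below_cd_kernel)
    fix g assume g: "below n g"
    have "((\<lambda>s. L s (\<pi> s n * g)) has_real_derivative L t (P' * g + \<pi> t n * 0) - \<gamma> * Mt t (\<pi> t n * g)) (at t)"
      using g below_P
      by (intro has_real_derivative_L[OF t has_poly_derivative_mult[OF P' has_poly_derivative_const],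
            where N = "n + n"] below_mult) auto
    moreover have "((\<lambda>s. L s (\<pi> s n * g)) has_real_derivative 0) (at t)"
    proof (rule has_field_derivative_transform_within_open[OF _ open_S t])
      show "0 = L s (\<pi> s n * g)" if "s \<in> S" for s
        using positive_functional.orth_poly_below[OF positive[OF that] g] by simp
    qed simp
    ultimately have "L t (P' * g) = \<gamma> * Mt t (\<pi> t n * g)"
      using DERIV_unique by fastforce
    moreover have "Mt t (\<pi> t n * g) = poly g t * Mt t (\<pi> t n)"
      using below_mono[OF g] by (intro orth_poly_cauchy_below) simp
    ultimately show "L t ((P' - smult (\<gamma> * Mt t (\<pi> t n)) (\<kappa> t n t)) * g) = 0"
      by (simp add: left_diff_distrib L_diff L_smult cd_kernel_reproducing[OF g])
  qed
  then show ?thesis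
    using P' by simp
qed

text \<open>P_n' has degree below n and is orthogonal to P_n, so only the variation of the
  functional contributes.\<close>

lemma has_real_derivative_h:
  assumes t: "t \<in> S"
  shows "((\<lambda>s. \<eta> s n) has_real_derivative - \<gamma> * Mt t (\<pi> t n * \<pi> t n)) (at t)"
proof -
  interpret cauchy_functional "L t" "Mt t" t
    using functional[OF t] .
  let ?P' = "smult (\<gamma> * Mt t (\<pi> t n)) (\<kappa> t n t)"
  have "((\<lambda>s. L s (\<pi> s n * \<pi> s n)) has_real_derivative
      L t (?P' * \<pi> t n + \<pi> t n * ?P') - \<gamma> * Mt t (\<pi> t n * \<pi> t n)) (at t)"
    using below_P t
    by (intro has_real_derivative_L[where N = "n + Suc n"] has_poly_derivative_mult
        has_poly_derivative_orth_poly below_mult) auto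
  moreover have "L t (?P' * \<pi> t n + \<pi> t n * ?P') = 0"
  proof -
    have "L t (?P' * \<pi> t n) = 0"
      by (simp add: L_smult cd_kernel_orth_poly)
    then show ?thesis
      by (simp only: L_add mult.commute[of "\<pi> t n" ?P'])
  qed
  ultimately have "((\<lambda>s. L s (\<pi> s n * \<pi> s n)) has_real_derivative - \<gamma> * Mt t (\<pi> t n * \<pi> t n)) (at t)"
    by simp
  then show ?thesis
    by (rule has_field_derivative_transform_within_open[OF _ open_S t])
      (simp add: orth_norm_def)
qed

text \<open>An entry of the Schlesinger equation for the residue matrix at \<open>a\<close>.\<close>

lemma has_real_derivative_off_diag:
  assumes t: "t \<in> S" and "a \<noteq> t"
    and functional_M: "\<And>s. s \<in> S \<Longrightarrow> cauchy_functional (L s) (M s) a"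
    and deriv_M: "\<And>p. ((\<lambda>s. M s p) has_real_derivative - \<gamma> * (Mt t p - M t p) / (t - a)) (at t)"
  shows "((\<lambda>s. M s (\<pi> s (Suc m) * \<pi> s m) / \<eta> s m) has_real_derivative
     \<gamma> / ((t - a) * (\<eta> t m)\<^sup>2) *
       (Mt t (\<pi> t (Suc m) * \<pi> t (Suc m)) * M t (\<pi> t m * \<pi> t m)
        - M t (\<pi> t (Suc m) * \<pi> t (Suc m)) * Mt t (\<pi> t m * \<pi> t m))) (at t)"
proof -
  interpret T: cauchy_functional "L t" "Mt t" t
    using functional[OF t] .
  interpret A: cauchy_functional "L t" "M t" a
    using functional_M[OF t] .
  have lin: "poly_linear (M s)" if "s \<in> S" for s
    using functional_M[OF that] cauchy_functional.M_linear by blast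
  have lin': "poly_linear (\<lambda>p. - \<gamma> * (Mt t p - M t p) / (t - a))"
    unfolding poly_linear_def
    by (simp add: T.M_add T.M_smult A.M_add A.M_smult diff_divide_distrib add_divide_distrib algebra_simps)
  let ?D = "\<lambda>n. smult (\<gamma> * Mt t (\<pi> t n)) (\<kappa> t n t)"
  define p r q s where "p = poly (\<pi> t (Suc m)) t" and "r = poly (\<pi> t m) t"
    and "q = Mt t (\<pi> t (Suc m))" and "s = Mt t (\<pi> t m)"
  define p0 r0 q0 s0 where "p0 = poly (\<pi> t (Suc m)) a" and "r0 = poly (\<pi> t m) a"
    and "q0 = M t (\<pi> t (Suc m))" and "s0 = M t (\<pi> t m)"
  define H k where "H = \<eta> t m" and "k = poly (\<kappa> t m t) a"
  note defs = p_def r_def q_def s_def p0_def r0_def q0_def s0_def H_def k_def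
  have H: "H \<noteq> 0" "r * q = p * s + H" "r0 * q0 = p0 * s0 + H"
    using T.h_nonzero T.cauchy_casorati A.cauchy_casorati by (simp_all add: defs)
  \<comment> \<open>Christoffel-Darboux for K_(m + 1)(x, t) at x = a, whose value is
    \<open>k + r * r0 / H\<close>.\<close>
  have cd: "(a - t) * (k + r * r0 / H) = r * p0 / H - p * r0 / H"
    using arg_cong[OF T.christoffel_darboux[of t m], of "\<lambda>f. poly f a"]
    by (simp add: defs cd_kernel_Suc) (simp add: algebra_simps diff_divide_distrib)
  have N: "((\<lambda>s. M s (\<pi> s (Suc m) * \<pi> s m)) has_real_derivative
      M t (?D (Suc m) * \<pi> t m + \<pi> t (Suc m) * ?D m)
        + - \<gamma> * (Mt t (\<pi> t (Suc m) * \<pi> t m) - M t (\<pi> t (Suc m) * \<pi> t m)) / (t - a)) (at t)"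
    by (rule has_real_derivative_functional[OF open_S t lin lin' deriv_M has_poly_derivative_mult,
          OF _ has_poly_derivative_orth_poly[OF t] has_poly_derivative_orth_poly[OF t]])
      (auto intro!: below_mult below_P)
  \<comment> \<open>The kernels have low enough degree for M to act as evaluation at a times M(P_m),
    and below as evaluation times M(P_(m + 1)).\<close>
  have "M t (\<kappa> t (Suc m) t * \<pi> t m) = (k + r * r0 / H) * s0"
    using A.orth_poly_cauchy_below[OF T.below_cd_kernel[of "Suc m" t]]
    by (simp add: mult.commute[of _ "\<pi> t m"] cd_kernel_Suc defs)
  moreover have "M t (\<pi> t (Suc m) * \<kappa> t m t) = k * q0"
    using A.orth_poly_cauchy_below[OF below_mono[OF T.below_cd_kernel], of m "Suc m" t] by (simp add: defs)
  ultimately have "((\<lambda>s. M s (\<pi> s (Suc m) * \<pi> s m)) has_real_derivative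
      (\<gamma> * q * ((k + r * r0 / H) * s0) + \<gamma> * s * (k * q0)) + - \<gamma> * (r * q - r0 * q0) / (t - a)) (at t)"
    using N by (simp add: A.M_add A.M_smult A.cauchy_off_diag T.cauchy_off_diag q_def s_def)
      (simp add: defs)
  from DERIV_divide[OF this has_real_derivative_h[OF t, of m]] H(1)
  have "((\<lambda>s. M s (\<pi> s (Suc m) * \<pi> s m) / \<eta> s m) has_real_derivative
      (((\<gamma> * q * ((k + r * r0 / H) * s0) + \<gamma> * s * (k * q0)) + - \<gamma> * (r * q - r0 * q0) / (t - a)) * H
        - (r0 * q0) * (- \<gamma> * (r * s))) / (H * H)) (at t)"
    by (simp add: A.cauchy_off_diag T.cauchy_diag defs)
  moreover have "(((\<gamma> * q * ((k + r * r0 / H) * s0) + \<gamma> * s * (k * q0)) + - \<gamma> * (r * q - r0 * q0) / (t - a)) * H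
        - (r0 * q0) * (- \<gamma> * (r * s))) / (H * H) = \<gamma> / ((t - a) * H\<^sup>2) * ((p * q) * (r0 * s0) - (p0 * q0) * (r * s))"
  proof -
    define X where "X = k + r * r0 / H"
    have "(t - a) * X = (p * r0 - r * p0) / H"
      using cd by (simp add: X_def algebra_simps diff_divide_distrib)
    then have "X = (p * r0 - r * p0) / (H * (t - a))"
      using H(1) \<open>a \<noteq> t\<close> by (simp add: field_simps)
    moreover have "k = X - r * r0 / H"
      by (simp add: X_def)
    moreover have "t - a \<noteq> 0"
      using \<open>a \<noteq> t\<close> by simp
    ultimately show ?thesis
      unfolding X_def[symmetric] using off_diag_identity[OF H(1) _ H(2,3)] by simp
  qed
  ultimately show ?thesis
    by (simp add: A.cauchy_diag T.cauchy_diag defs)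
qed

end

section \<open>Deformed Jacobi functionals\<close>

locale jacobi_deformation = deformed_functional L Mt \<gamma> "{0<..<1}"
  for L Mt :: "real \<Rightarrow> real poly \<Rightarrow> real" and \<gamma> :: real +
  fixes M0 M1 :: "real \<Rightarrow> real poly \<Rightarrow> real" and \<alpha> \<beta> :: real
  assumes functional_0: "t \<in> {0<..<1} \<Longrightarrow> cauchy_functional (L t) (M0 t) 0"
    and functional_1: "t \<in> {0<..<1} \<Longrightarrow> cauchy_functional (L t) (M1 t) 1"
    and parts: "t \<in> {0<..<1} \<Longrightarrow> L t (pderiv p) + \<alpha> * M0 t p + \<beta> * M1 t p + \<gamma> * Mt t p = 0"
    and deriv_M0: "t \<in> {0<..<1} \<Longrightarrow>
      ((\<lambda>s. M0 s p) has_real_derivative - \<gamma> * (Mt t p - M0 t p) / (t - 0)) (at t)"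
    and deriv_M1: "t \<in> {0<..<1} \<Longrightarrow>
      ((\<lambda>s. M1 s p) has_real_derivative - \<gamma> * (Mt t p - M1 t p) / (t - 1)) (at t)"
begin

text \<open>\<open>off_diag\<close> is V_a, while \<open>diag\<close> is U_a for
  \<open>n = Suc m\<close> and W_a h_m^2 for \<open>n = m\<close>. The names refer to the pairing of
  the P_k, not to positions in the residue matrix.\<close>

definition "off_diag \<theta> M t m = \<theta> * (M t (\<pi> t (Suc m) * \<pi> t m) / \<eta> t m)"
definition "diag \<theta> M t m n = \<theta> * M t (\<pi> t n * \<pi> t n)"

text \<open>Both V = \<theta> r q / H and, by Casorati, V - \<theta> = \<theta> p s / H are
  products, and so are the two diagonal terms; the four factors p, q, r, s are merely
  regrouped.\<close>

lemma diag_mult: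
  assumes "cauchy_functional (L t) (M t) a"
  shows "diag \<theta> M t m (Suc m) * diag \<theta> M t m m / (\<eta> t m)\<^sup>2 = off_diag \<theta> M t m * (off_diag \<theta> M t m - \<theta>)"
proof -
  interpret cauchy_functional "L t" "M t" a
    by fact
  define p r q s H where "p = poly (\<pi> t (Suc m)) a" and "r = poly (\<pi> t m) a"
    and "q = M t (\<pi> t (Suc m))" and "s = M t (\<pi> t m)" and "H = \<eta> t m"
  note defs = p_def r_def q_def s_def H_def
  have H: "H \<noteq> 0" and rq: "r * q - H = p * s"
    using h_nonzero cauchy_casorati by (simp_all add: defs)
  have "\<theta> * (p * q) * (\<theta> * (r * s)) / H\<^sup>2 = \<theta> * (r * q / H) * (\<theta> * ((p * s) / H))"
    using H by (simp add: power2_eq_square)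
  also have "\<theta> * (p * s / H) = \<theta> * (r * q / H) - \<theta>"
    unfolding rq[symmetric] using H by (simp add: field_simps)
  finally show ?thesis
    by (simp add: diag_def off_diag_def cauchy_diag cauchy_off_diag defs)
qed

lemma sum_diag:
  assumes t: "t \<in> {0<..<1}"
  shows "diag \<alpha> M0 t m n + diag \<beta> M1 t m n + diag \<gamma> Mt t m n = 0"
proof -
  interpret cauchy_functional "L t" "Mt t" t
    using functional[OF t] .
  have "L t (\<pi> t n * pderiv (\<pi> t n)) = 0"
    by (intro orth_poly_below below_pderiv below_orth_poly)
  then have "L t (pderiv (\<pi> t n * \<pi> t n)) = 0"
    by (simp only: pderiv_mult L_add)
  then show ?thesis
    using parts[OF t, of "\<pi> t n * \<pi> t n"] by (simp add: diag_def)
qed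

lemma sum_off_diag:
  assumes t: "t \<in> {0<..<1}"
  shows "off_diag \<alpha> M0 t m + off_diag \<beta> M1 t m + off_diag \<gamma> Mt t m = - real (Suc m)"
proof -
  interpret cauchy_functional "L t" "Mt t" t
    using functional[OF t] .
  have "L t (\<pi> t (Suc m) * pderiv (\<pi> t m)) = 0"
    by (intro orth_poly_below below_pderiv below_mono[OF below_orth_poly]) simp
  moreover have "L t (\<pi> t m * pderiv (\<pi> t (Suc m))) = real (Suc m) * \<eta> t m"
    by (subst orth_poly_below_Suc) (auto intro: below_pderiv below_orth_poly simp: coeff_pderiv coeff_orth_poly)
  ultimately have "L t (pderiv (\<pi> t (Suc m) * \<pi> t m)) = real (Suc m) * \<eta> t m"
    by (simp add: pderiv_mult L_add)
  then have "\<alpha> * M0 t (\<pi> t (Suc m) * \<pi> t m) + \<beta> * M1 t (\<pi> t (Suc m) * \<pi> t m) + \<gamma> * Mt t (\<pi> t (Suc m) * \<pi> t m)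
      = - real (Suc m) * \<eta> t m"
    using parts[OF t, of "\<pi> t (Suc m) * \<pi> t m"] by (simp add: algebra_simps)
  then show ?thesis
    using h_nonzero[of m] by (simp add: off_diag_def field_simps)
qed

text \<open>Integration by parts for x P_(m + 1) P_m. Because L(P_(m + 1) P_m) = 0, multiplication
  by x acts under M_a as the scalar a; the term at 0 disappears.\<close>

lemma sum_weighted_off_diag:
  assumes t: "t \<in> {0<..<1}"
  shows "off_diag \<beta> M1 t m + t * off_diag \<gamma> Mt t m = subleading (L t) (Suc m)"
proof -
  interpret T: cauchy_functional "L t" "Mt t" t
    using functional[OF t] .
  interpret A0: cauchy_functional "L t" "M0 t" 0
    using functional_0[OF t] .
  interpret A1: cauchy_functional "L t" "M1 t" 1
    using functional_1[OF t] .
  let ?x = "[:0, 1:] :: real poly"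
  let ?P = "\<pi> t (Suc m)" and ?R = "\<pi> t m"
  let ?g = "?P * ?R"
  have 0: "L t ?g = 0"
    by (rule T.orth_poly_orthogonal) simp
  have M0: "M0 t (?x * ?g) = 0"
    using A0.M_shift[of ?g] 0 by simp
  have "?x * ?g = [:-1, 1:] * ?g + ?g"
    by simp
  then have M1: "M1 t (?x * ?g) = M1 t ?g"
    using A1.M_shift[of ?g] 0 by (simp only: A1.M_add)
  have "?x * ?g = [:- t, 1:] * ?g + smult t ?g"
    by (simp add: algebra_simps)
  then have Mt: "Mt t (?x * ?g) = t * Mt t ?g"
    using T.M_shift[of ?g] 0 by (simp only: T.M_add T.M_smult)
  have 1: "L t (?P * (?x * pderiv ?R)) = 0"
    by (intro T.orth_poly_below below_linear_mult below_pderiv T.below_orth_poly)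
  \<comment> \<open>The operator x d/dx multiplies the coefficient of x^i by i, so \<open>?e\<close>
    loses its leading term and keeps minus the subleading coefficient at x^m.\<close>
  let ?e = "?x * pderiv ?P - smult (real (Suc m)) ?P"
  have c: "coeff ?e i = (real i - real (Suc m)) * coeff ?P i" for i
    by (cases i) (auto simp: coeff_pderiv algebra_simps)
  have "below (Suc m) ?e"
    unfolding below_def c
  proof (intro allI impI)
    show "(real i - real (Suc m)) * coeff ?P i = 0" if "i \<ge> Suc m" for i
      using T.below_orth_poly[of "Suc m"] that by (cases "i = Suc m") (auto simp: below_def)
  qed
  from T.orth_poly_below_Suc[OF this] have "L t (?R * ?e) = - subleading (L t) (Suc m) * \<eta> t m"
    unfolding c subleading_Suc by simp
  moreover have "L t (?R * ?P) = 0"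
    using 0 by (simp add: mult.commute)
  ultimately have 2: "L t (?R * (?x * pderiv ?P)) = - subleading (L t) (Suc m) * \<eta> t m"
    by (simp only: right_diff_distrib T.L_diff mult_smult_right T.L_smult)
  have "pderiv (?x * ?g) = ?g + (?P * (?x * pderiv ?R) + ?R * (?x * pderiv ?P))"
    by (simp add: pderiv_mult pderiv_pCons algebra_simps)
  then have "L t (pderiv (?x * ?g)) = - subleading (L t) (Suc m) * \<eta> t m"
    using 0 1 2 by (simp only: T.L_add)
  then have "\<beta> * M1 t ?g + \<gamma> * (t * Mt t ?g) = subleading (L t) (Suc m) * \<eta> t m"
    using parts[OF t, of "?x * ?g"] M0 M1 Mt by simp
  then show ?thesis
    using T.h_nonzero[of m] by (simp add: off_diag_def field_simps)
qed

text \<open>The top coefficient of K_(m + 1)(x, t) is P_m(t) / h_m, and P_m(t) M_t(P_(m + 1)) =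
  M_t(P_(m + 1) P_m).\<close>

lemma has_real_derivative_subleading:
  assumes t: "t \<in> {0<..<1}"
  shows "((\<lambda>s. subleading (L s) (Suc m)) has_real_derivative off_diag \<gamma> Mt t m) (at t)"
proof -
  interpret cauchy_functional "L t" "Mt t" t
    using functional[OF t] .
  have "coeff (\<kappa> t (Suc m) t) m = poly (\<pi> t m) t / \<eta> t m"
    using below_cd_kernel[of m t] by (simp add: cd_kernel_Suc coeff_orth_poly below_def)
  then have "coeff (smult (\<gamma> * Mt t (\<pi> t (Suc m))) (\<kappa> t (Suc m) t)) m = off_diag \<gamma> Mt t m"
    by (simp add: off_diag_def cauchy_off_diag)
  then show ?thesis
    using has_poly_derivative_orth_poly[OF t, of "Suc m"] unfolding has_poly_derivative_def subleading_Suc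
    by metis
qed

text \<open>V_t is differentiated through V_0 + V_1 + V_t = -n. The number T is only asserted to
  exist with a given square, since the square alone is expressed by the V_a.\<close>

lemma has_real_derivative_off_diag_t:
  fixes t :: real and m :: nat
  assumes t: "t \<in> {0<..<1}"
  defines "V0 \<equiv> off_diag \<alpha> M0 t m" and "V1 \<equiv> off_diag \<beta> M1 t m" and "Vt \<equiv> off_diag \<gamma> Mt t m"
  shows "\<exists>T. ((\<lambda>s. off_diag \<gamma> Mt s m) has_real_derivative T / (t * (t - 1))) (at t) \<and>
    T\<^sup>2 = (Vt * (Vt - \<gamma>) - V0 * (V0 - \<alpha>) - V1 * (V1 - \<beta>))\<^sup>2 - 4 * (V0 * (V0 - \<alpha>)) * (V1 * (V1 - \<beta>))"
proof -
  interpret cauchy_functional "L t" "Mt t" t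
    using functional[OF t] .
  define U0 U1 Ut W0 W1 Wt where "U0 = diag \<alpha> M0 t m (Suc m)" and "U1 = diag \<beta> M1 t m (Suc m)"
    and "Ut = diag \<gamma> Mt t m (Suc m)" and "W0 = diag \<alpha> M0 t m m / (\<eta> t m)\<^sup>2"
    and "W1 = diag \<beta> M1 t m m / (\<eta> t m)\<^sup>2" and "Wt = diag \<gamma> Mt t m m / (\<eta> t m)\<^sup>2"
  note defs = U0_def U1_def Ut_def W0_def W1_def Wt_def
  have Ut: "Ut = - U0 - U1"
    using sum_diag[OF t, of m "Suc m"] by (simp add: defs)
  have Wt: "Wt = - W0 - W1"
  proof -
    have "diag \<gamma> Mt t m m = - diag \<alpha> M0 t m m - diag \<beta> M1 t m m"
      using sum_diag[OF t, of m m] by simp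
    then show ?thesis
      by (simp add: defs diff_divide_distrib)
  qed
  have UW: "U0 * W0 = V0 * (V0 - \<alpha>)" "U1 * W1 = V1 * (V1 - \<beta>)" "Ut * Wt = Vt * (Vt - \<gamma>)"
    using diag_mult[of t M0 0 \<alpha> m, OF functional_0[OF t]] diag_mult[of t M1 1 \<beta> m, OF functional_1[OF t]]
      diag_mult[of t Mt t \<gamma> m, OF functional[OF t]]
    by (simp_all add: defs V0_def V1_def Vt_def)
  have S: "t \<noteq> 0" "t - 1 \<noteq> 0" using t by auto
  let ?T = "U0 * W1 - U1 * W0"
  have "((\<lambda>s. off_diag \<alpha> M0 s m) has_real_derivative \<alpha> * (\<gamma> / ((t - 0) * (\<eta> t m)\<^sup>2) *
       (Mt t (\<pi> t (Suc m) * \<pi> t (Suc m)) * M0 t (\<pi> t m * \<pi> t m)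
        - M0 t (\<pi> t (Suc m) * \<pi> t (Suc m)) * Mt t (\<pi> t m * \<pi> t m)))) (at t)"
    unfolding off_diag_def
    by (intro DERIV_cmult has_real_derivative_off_diag t functional_0 deriv_M0) (use t in auto)
  moreover have "\<alpha> * (\<gamma> / ((t - 0) * (\<eta> t m)\<^sup>2) *
       (Mt t (\<pi> t (Suc m) * \<pi> t (Suc m)) * M0 t (\<pi> t m * \<pi> t m)
        - M0 t (\<pi> t (Suc m) * \<pi> t (Suc m)) * Mt t (\<pi> t m * \<pi> t m))) = (Ut * W0 - U0 * Wt) / t"
    using S h_nonzero[of m] by (simp add: defs diag_def field_simps)
  moreover have "(Ut * W0 - U0 * Wt) / t = ?T / t"
    unfolding Ut Wt by (simp add: algebra_simps)
  ultimately have V0': "((\<lambda>s. off_diag \<alpha> M0 s m) has_real_derivative ?T / t) (at t)"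
    by simp
  have "((\<lambda>s. off_diag \<beta> M1 s m) has_real_derivative \<beta> * (\<gamma> / ((t - 1) * (\<eta> t m)\<^sup>2) *
       (Mt t (\<pi> t (Suc m) * \<pi> t (Suc m)) * M1 t (\<pi> t m * \<pi> t m)
        - M1 t (\<pi> t (Suc m) * \<pi> t (Suc m)) * Mt t (\<pi> t m * \<pi> t m)))) (at t)"
    unfolding off_diag_def
    by (intro DERIV_cmult has_real_derivative_off_diag t functional_1 deriv_M1) (use t in auto)
  moreover have "\<beta> * (\<gamma> / ((t - 1) * (\<eta> t m)\<^sup>2) *
       (Mt t (\<pi> t (Suc m) * \<pi> t (Suc m)) * M1 t (\<pi> t m * \<pi> t m)
        - M1 t (\<pi> t (Suc m) * \<pi> t (Suc m)) * Mt t (\<pi> t m * \<pi> t m))) = (Ut * W1 - U1 * Wt) / (t - 1)"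
  proof -
    have "\<beta> * (\<gamma> / (d * H) * (a * b - c * e)) = (\<gamma> * a * (\<beta> * b / H) - \<beta> * c * (\<gamma> * e / H)) / d"
      if "d \<noteq> 0" "H \<noteq> 0" for a b c d e H :: real
      using that by (simp add: field_simps)
    then show ?thesis
      using S h_nonzero[of m] by (simp add: defs diag_def)
  qed
  moreover have "(Ut * W1 - U1 * Wt) / (t - 1) = - ?T / (t - 1)"
    unfolding Ut Wt by (simp add: algebra_simps)
  ultimately have V1': "((\<lambda>s. off_diag \<beta> M1 s m) has_real_derivative - ?T / (t - 1)) (at t)"
    by simp
  have "((\<lambda>s. - real (Suc m) - off_diag \<alpha> M0 s m - off_diag \<beta> M1 s m) has_real_derivative
      0 - ?T / t - (- ?T / (t - 1))) (at t)"
    by (intro DERIV_diff DERIV_const V0' V1')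
  moreover have "0 - ?T / t - (- ?T / (t - 1)) = ?T / (t * (t - 1))"
    using S by (simp add: divide_simps) (simp add: algebra_simps)
  ultimately have "((\<lambda>s. - real (Suc m) - off_diag \<alpha> M0 s m - off_diag \<beta> M1 s m) has_real_derivative
      ?T / (t * (t - 1))) (at t)"
    by simp
  then have "((\<lambda>s. off_diag \<gamma> Mt s m) has_real_derivative ?T / (t * (t - 1))) (at t)"
    by (rule has_field_derivative_transform_within_open[OF _ open_S t])
      (simp add: sum_off_diag[symmetric, of _ m] algebra_simps del: of_nat_Suc)
  \<comment> \<open>This is (x - y)^2 = (x + y)^2 - 4 x y for x = U_0 W_1 and y = U_1 W_0; their sum
    is read off from U_t W_t = (U_0 + U_1)(W_0 + W_1).\<close>
  moreover have "?T\<^sup>2 = (Ut * Wt - U0 * W0 - U1 * W1)\<^sup>2 - 4 * (U0 * W0) * (U1 * W1)"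
    unfolding Ut Wt by (simp add: power2_eq_square algebra_simps)
  ultimately show ?thesis
    unfolding UW by blast
qed

text \<open>By \<open>h\<^sub>k' = - \<gamma> M\<^sub>t (P\<^sub>k\<^sup>2)\<close>, the left-hand side is \<open>t (t - 1)\<close> times the logarithmic derivative of
  the Hankel determinant. Each summand comes from integrating \<open>x (x - 1) P\<^sub>k\<^sup>2\<close> by parts.\<close>

lemma trace_formula:
  assumes t: "t \<in> {0<..<1}"
  shows "t * (t - 1) * (\<Sum>k<n. - \<gamma> * Mt t (\<pi> t k * \<pi> t k) / \<eta> t k)
     = - (2 * real n + \<alpha> + \<beta> + \<gamma>) * subleading (L t) n - (real n)\<^sup>2 - real n * \<alpha> + real n * \<gamma> * (t - 1)"
proof (induction n)
  case 0
  show ?case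
    by (simp add: subleading_def)
next
  case (Suc k)
  interpret T: cauchy_functional "L t" "Mt t" t
    using functional[OF t] .
  interpret A0: cauchy_functional "L t" "M0 t" 0
    using functional_0[OF t] .
  interpret A1: cauchy_functional "L t" "M1 t" 1
    using functional_1[OF t] .
  let ?x = "[:0, 1:] :: real poly" and ?y = "[:-1, 1:] :: real poly"
  let ?P = "\<pi> t k" and ?N = "\<pi> t (Suc k)"
  let ?g = "?P * ?P" and ?H = "\<eta> t k"
  define s0 s1 where "s0 = subleading (L t) k" and "s1 = subleading (L t) (Suc k)"
  have cP: "coeff ?P i = 0" if "i > k" for i
    using T.below_orth_poly[of k] that by (auto simp: below_def)
  have cN: "coeff ?N i = 0" if "i > Suc k" for i
    using T.below_orth_poly[of "Suc k"] that by (auto simp: below_def)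
  \<comment> \<open>For k = 0 the index \<open>k - 1\<close> is 0 and reads the leading coefficient
    1, although \<open>subleading\<close> is 0 there.\<close>
  have s: "coeff ?P (k - 1) = (if k = 0 then 1 else s0)" "coeff ?N k = s1"
    by (auto simp: s0_def s1_def subleading_def T.orth_poly_0)
  have g: "L t ?g = ?H" and PN: "L t (?P * ?N) = 0"
    using T.orth_poly_orthogonal[of k "Suc k"] by (simp_all add: orth_norm_def mult.commute)
  have xg: "L t (?x * ?g) = (s0 - s1) * ?H"
  proof -
    let ?e = "?x * ?P - ?N"
    have "below (Suc k) ?e"
      unfolding below_def
    proof (intro allI impI)
      show "coeff ?e i = 0" if "i \<ge> Suc k" for i
        using that cP cN T.coeff_orth_poly[of k] T.coeff_orth_poly[of "Suc k"]
        by (cases "i = Suc k") (auto simp: coeff_pCons split: nat.splits)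
    qed
    from T.orth_poly_below_Suc[OF this] have "L t (?P * ?e) = coeff ?e k * ?H" .
    moreover have "coeff ?e k = s0 - s1"
      using s by (cases k) (auto simp: s0_def subleading_def)
    moreover have "?x * ?g = ?P * ?e + ?P * ?N"
      by (simp add: algebra_simps)
    ultimately show ?thesis
      using PN by (simp only: T.L_add)
  qed
  have D: "L t (?P * (?x * (?y * pderiv ?P))) = (- s0 - real k + real k * (s0 - s1)) * ?H"
  proof -
    \<comment> \<open>The leading term k x^(k + 1) of x (x - 1) P_k' is removed by k P_(k + 1),
      which is orthogonal to P_k.\<close>
    let ?e = "?x * (?y * pderiv ?P) - smult (real k) ?N"
    have c: "coeff ?e (Suc i) = (real i) * coeff ?P i - (real (Suc i)) * coeff ?P (Suc i) - real k * coeff ?N (Suc i)" for i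
      by (cases i) (auto simp: coeff_pderiv algebra_simps)
    have "below (Suc k) ?e"
      unfolding below_def
    proof (intro allI impI)
      fix i assume "i \<ge> Suc k"
      then obtain j where j: "i = Suc j" "j \<ge> k"
        by (cases i) auto
      show "coeff ?e i = 0"
        unfolding j(1) c using j(2) cP[of j] cP[of "Suc j"] cN[of "Suc j"] T.coeff_orth_poly[of k] T.coeff_orth_poly[of "Suc k"]
        by (cases "j = k") auto
    qed
    from T.orth_poly_below_Suc[OF this] have "L t (?P * ?e) = coeff ?e k * ?H" .
    moreover have "coeff ?e k = - s0 - real k + real k * (s0 - s1)"
    proof (cases k)
      case 0
      then show ?thesis by (simp add: s0_def subleading_def)
    next
      case (Suc j)
      have "coeff ?e k = coeff ?e (Suc j)"
        by (simp only: Suc)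
      also have "\<dots> = real j * s0 - real (Suc j) - real k * s1"
        unfolding c using s T.coeff_orth_poly[of k] by (simp add: Suc)
      finally show ?thesis
        by (simp add: Suc algebra_simps)
    qed
    moreover have "?P * (?x * (?y * pderiv ?P)) = ?P * ?e + smult (real k) (?P * ?N)"
      by (simp add: algebra_simps)
    ultimately show ?thesis
      using PN by (simp only: T.L_add T.L_smult)
  qed
  have yg: "L t (?y * ?g) = (s0 - s1) * ?H - ?H"
  proof -
    have "?y * ?g = ?x * ?g - ?g" by simp
    then show ?thesis using xg g by (simp only: T.L_diff)
  qed
  have f0: "M0 t (?x * (?y * ?g)) = (s0 - s1) * ?H - ?H"
    using A0.M_shift[of "?y * ?g"] yg by simp
  have f1: "M1 t (?x * (?y * ?g)) = (s0 - s1) * ?H"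
  proof -
    have "?x * (?y * ?g) = ?y * (?x * ?g)" by (rule mult.left_commute)
    then show ?thesis using A1.M_shift[of "?x * ?g"] xg by simp
  qed
  have ft: "Mt t (?x * (?y * ?g)) = (s0 - s1) * ?H + (t - 1) * ?H + t * (t - 1) * Mt t ?g"
  proof -
    \<comment> \<open>Division with remainder: x (x - 1) = (x - t)(x + t - 1) + t (t - 1).\<close>
    have "?x * (?y * ?g) = [:- t, 1:] * (?x * ?g + smult (t - 1) ?g) + smult (t * (t - 1)) ?g"
      by (subst poly_eq_poly_eq_iff[symmetric], rule ext) (simp add: algebra_simps)
    then show ?thesis
      using xg g by (simp only: T.M_add T.M_smult T.M_shift T.L_add T.L_smult)
  qed
  have fd: "L t (pderiv (?x * (?y * ?g))) = 2 * (s0 - s1) * ?H - ?H + 2 * ((- s0 - real k + real k * (s0 - s1)) * ?H)"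
  proof -
    have pd: "pderiv ?x = 1" "pderiv ?y = 1"
      by (simp_all add: pderiv_pCons)
    have "pderiv (?x * (?y * ?g)) = (?x * ?g + ?y * ?g) + smult 2 (?P * (?x * (?y * pderiv ?P)))"
      unfolding pderiv_mult pd
      by (subst poly_eq_poly_eq_iff[symmetric], rule ext) (simp add: algebra_simps)
    then show ?thesis
      using xg yg D by (simp only: T.L_add T.L_smult)
  qed
  define m where "m = Mt t ?g"
  have "?H * (2 * (s0 - s1) - 1 + 2 * (- s0 - real k + real k * (s0 - s1)) + \<alpha> * ((s0 - s1) - 1) + \<beta> * (s0 - s1)
     + \<gamma> * ((s0 - s1) + (t - 1))) + \<gamma> * (t * (t - 1) * m) = 0"
    using parts[OF t, of "?x * (?y * ?g)"] unfolding f0 f1 ft fd m_def[symmetric] by (simp add: algebra_simps)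
  \<comment> \<open>The right-hand side is (2k + \<alpha> + \<beta> + \<gamma>) s0 - (2k + 2 +
    \<alpha> + \<beta> + \<gamma>) s1 - (2k + 1) - \<alpha> + \<gamma> (t - 1), so the sum over k
    telescopes.\<close>
  then have "t * (t - 1) * (- \<gamma> * m / ?H) = 2 * (s0 - s1) - 1 + 2 * (- s0 - real k + real k * (s0 - s1))
     + \<alpha> * ((s0 - s1) - 1) + \<beta> * (s0 - s1) + \<gamma> * ((s0 - s1) + (t - 1))"
    using T.h_nonzero[of k] by (simp add: field_simps)
  then show ?case
    using Suc unfolding sum.lessThan_Suc distrib_left m_def[symmetric] s0_def[symmetric] s1_def[symmetric]
    by (simp add: algebra_simps power2_eq_square)
qed

end

section \<open>The Hankel determinant and the sigma form\<close>

text \<open>The matrix E of coefficients of the P_k is lower triangular with ones on the diagonal,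
  and orthogonality says that E A E^T is diagonal with entries h_k.\<close>

lemma (in positive_functional) hankel_det_eq_prod:
  "(\<Sum>p | p permutes {..<n}. of_int (sign p) * (\<Prod>i<n. L (monom 1 (i + p i)))) = (\<Prod>k<n. h k)"
proof -
  define A where "A = mat n n (\<lambda>(i, j). L (monom 1 (i + j)))"
  define E where "E = mat n n (\<lambda>(k, i). coeff (P k) i)"
  define D where "D = mat n n (\<lambda>(k, l). if k = l then h k else 0)"
  have carrier: "A \<in> carrier_mat n n" "E \<in> carrier_mat n n" "D \<in> carrier_mat n n"
    by (auto simp: A_def E_def D_def)
  have P: "P k = (\<Sum>i<n. monom (coeff (P k) i) i)" if "k < n" for k
    using that by (intro below_eq_sum_monom below_mono[OF below_orth_poly]) auto
  have "E * A * transpose_mat E = D"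
  proof (rule eq_matI)
    fix k l assume "k < dim_row D" "l < dim_col D"
    then have kl: "k < n" "l < n"
      by (auto simp: D_def)
    have "L (P k * P l) = (\<Sum>i<n. \<Sum>j<n. coeff (P k) i * L (monom 1 (i + j)) * coeff (P l) j)"
    proof -
      have "L (P k * P l) = L (\<Sum>i<n. \<Sum>j<n. monom (coeff (P k) i) i * monom (coeff (P l) j) j)"
        by (subst P[OF kl(1)], subst P[OF kl(2)]) (simp add: sum_product)
      also have "\<dots> = (\<Sum>i<n. \<Sum>j<n. L (smult (coeff (P k) i * coeff (P l) j) (monom 1 (i + j))))"
        by (simp add: L_sum mult_monom smult_monom)
      finally show ?thesis
        by (simp add: L_smult mult_ac)
    qed
    moreover have "L (P k * P l) = D $$ (k, l)"
      using kl orth_poly_orthogonal[of k l] orth_poly_orthogonal[of l k]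
      by (cases k l rule: linorder_cases) (auto simp: D_def orth_norm_def mult.commute)
    moreover have "(E * A * transpose_mat E) $$ (k, l)
        = (\<Sum>j<n. (\<Sum>i<n. coeff (P k) i * L (monom 1 (i + j))) * coeff (P l) j)"
      using kl by (simp add: E_def A_def scalar_prod_def lessThan_atLeast0)
    moreover have "\<dots> = (\<Sum>i<n. \<Sum>j<n. coeff (P k) i * L (monom 1 (i + j)) * coeff (P l) j)"
      unfolding sum_distrib_right by (rule sum.swap)
    ultimately show "(E * A * transpose_mat E) $$ (k, l) = D $$ (k, l)"
      by simp
  qed (use carrier in auto)
  moreover have "det E = 1"
  proof -
    have "det E = prod_list (diag_mat E)"
      using below_orth_poly carrier by (intro det_lower_triangular[of n]) (auto simp: E_def below_def)
    also have "diag_mat E = replicate n 1"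
      by (auto simp: diag_mat_def E_def coeff_orth_poly intro!: nth_equalityI)
    finally show ?thesis by simp
  qed
  moreover have "det (E * A * transpose_mat E) = det E * det A * det E"
    using carrier by (simp add: det_mult[of _ n] det_transpose[of _ n])
  ultimately have "det A = det D"
    by simp
  also have "det D = prod_list (diag_mat D)"
    using carrier by (intro det_lower_triangular[of n]) (auto simp: D_def)
  also have "\<dots> = (\<Prod>k<n. h k)"
    by (simp add: prod_list_diag_prod D_def lessThan_atLeast0)
  finally show ?thesis
    using det_def'[OF carrier(1)] by (simp add: A_def lessThan_atLeast0)
qed

text \<open>Here \<open>p\<close> is the subleading coefficient, \<open>v\<close> its derivative, \<open>s\<close>, \<open>d\<close> the values of \<open>\<sigma>\<close> and
  \<open>\<sigma>'\<close>, and \<open>N\<^sup>2 * S\<close> that of \<open>(t (t - 1) \<sigma>'')\<^sup>2\<close>.\<close>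

lemma sigma_form_identity:
  fixes n \<alpha> \<beta> \<gamma> t p v S :: real
  defines "\<nu>1 \<equiv> (\<alpha> + \<beta>) / 2" and "\<nu>2 \<equiv> (\<beta> - \<alpha>) / 2"
    and "\<nu>3 \<equiv> (2 * n + \<alpha> + \<beta>) / 2" and "\<nu>4 \<equiv> (2 * n + \<alpha> + \<beta> + 2 * \<gamma>) / 2"
    and "N \<equiv> 2 * n + \<alpha> + \<beta> + \<gamma>" and "V1 \<equiv> p - t * v" and "V0 \<equiv> - n - (p - t * v) - v"
  defines "s \<equiv> - N * p - n\<^sup>2 - n * \<alpha> + n * \<gamma> * (t - 1)
      + (- n * (n + \<alpha> + \<beta> + \<gamma>) - (\<alpha> + \<beta>)\<^sup>2 / 4) * t
      + (2 * n * (n + \<alpha> + \<beta> + \<gamma>) + (\<alpha> + \<beta>) * \<beta> - (\<alpha> - \<beta>) * \<gamma>) / 4"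
    and "d \<equiv> - N * v + n * \<gamma> + (- n * (n + \<alpha> + \<beta> + \<gamma>) - (\<alpha> + \<beta>)\<^sup>2 / 4)"
  assumes S: "S = (v * (v - \<gamma>) - V0 * (V0 - \<alpha>) - V1 * (V1 - \<beta>))\<^sup>2 - 4 * (V0 * (V0 - \<alpha>)) * (V1 * (V1 - \<beta>))"
  shows "d * (N\<^sup>2 * S) + (2 * d * (t * d - s) - d\<^sup>2 - \<nu>1 * \<nu>2 * \<nu>3 * \<nu>4)\<^sup>2
    = (d + \<nu>1\<^sup>2) * (d + \<nu>2\<^sup>2) * (d + \<nu>3\<^sup>2) * (d + \<nu>4\<^sup>2)"
proof -
  have sub: "\<alpha> = \<nu>1 - \<nu>2" "\<beta> = \<nu>1 + \<nu>2" "n = \<nu>3 - \<nu>1" "\<gamma> = \<nu>4 - \<nu>3" "N = \<nu>3 + \<nu>4"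
    by (simp_all add: \<nu>1_def \<nu>2_def \<nu>3_def \<nu>4_def N_def field_simps)
  \<comment> \<open>Subtracting t d eliminates t: \<open>y\<close> depends on t and p only through
    V1.\<close>
  define y where "y = s - t * d"
  \<comment> \<open>The constant c_1 completes a square: n \<gamma> + c_1 =
    -\<open>\<nu>3\<close>^2. In the same way c_2 makes the constant term of \<open>2 * y\<close> a
    polynomial in the \<nu>.\<close>
  have d: "d = - (N * v + \<nu>3\<^sup>2)"
    unfolding d_def \<nu>3_def by (simp add: power2_eq_square field_simps)
  have y: "2 * y = - 2 * N * V1 + (\<nu>1 + \<nu>2) * (\<nu>3 + \<nu>4) - \<nu>1 * \<nu>2 - \<nu>3 * \<nu>4"
    unfolding y_def s_def d_def V1_def N_def \<nu>1_def \<nu>2_def \<nu>3_def \<nu>4_def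
    by (simp add: power2_eq_square field_simps)
  have e: "2 * d * (t * d - s) = - d * (2 * y)"
    by (simp add: y_def algebra_simps)
  have V0: "V0 = - (\<nu>3 - \<nu>1) - V1 - v"
    by (simp add: V0_def V1_def sub)
  show ?thesis
    unfolding e unfolding S V0 y unfolding d unfolding sub
    by Groebner_Basis.algebra
qed

text \<open>The analytic and the algebraic halves meet here. M_1 carries a minus sign because
  lowering the exponent of 1 - x divides by 1 - x instead of x - 1.\<close>

lemma jacobi_deformation_weight:
  assumes "\<alpha> > 0" "\<beta> > 0" "\<gamma> > 0" "A \<ge> 0" "A + B \<ge> 0" "\<not> (A = 0 \<and> A + B = 0)"
  shows "jacobi_deformation (weight_int \<alpha> \<beta> \<gamma> A B) (weight_cauchy \<alpha> \<beta> \<gamma> A B) \<gamma>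
    (weight_int (\<alpha> - 1) \<beta> \<gamma> A B) (\<lambda>t p. - weight_int \<alpha> (\<beta> - 1) \<gamma> A B t p) \<alpha> \<beta>"
proof (intro jacobi_deformation.intro deformed_functional.intro jacobi_deformation_axioms.intro)
  fix t :: real assume "t \<in> {0<..<1}"
  then have t: "0 < t" "t < 1" by auto
  have L: "poly_linear (weight_int a b \<gamma> A B t)" if "a > -1" "b > -1" for a b
    unfolding poly_linear_def using weight_int_add[of a b \<gamma> t] weight_int_smult that assms(3) t by blast
  have Mt: "poly_linear (weight_cauchy \<alpha> \<beta> \<gamma> A B t)"
    unfolding poly_linear_def using weight_cauchy_add[of \<alpha> \<beta> \<gamma> t] weight_cauchy_smult[of \<alpha> \<beta> \<gamma> t] assms t by auto
  have pos: "positive_functional (weight_int \<alpha> \<beta> \<gamma> A B t)"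
    using L[of \<alpha> \<beta>] weight_int_pos[of \<alpha> \<beta> \<gamma> t A B] assms t by unfold_locales auto
  show "cauchy_functional (weight_int \<alpha> \<beta> \<gamma> A B t) (weight_cauchy \<alpha> \<beta> \<gamma> A B t) t"
    using pos Mt weight_cauchy_shift[of \<alpha> \<beta> \<gamma> t] assms t
    by (intro cauchy_functional.intro cauchy_functional_axioms.intro) auto
  show "cauchy_functional (weight_int \<alpha> \<beta> \<gamma> A B t) (weight_int (\<alpha> - 1) \<beta> \<gamma> A B t) 0"
    using pos L[of "\<alpha> - 1" \<beta>] weight_int_pred_left assms t
    by (intro cauchy_functional.intro cauchy_functional_axioms.intro) auto
  have "poly_linear (\<lambda>p. - weight_int \<alpha> (\<beta> - 1) \<gamma> A B t p)"
    using L[of \<alpha> "\<beta> - 1"] assms by (simp add: poly_linear_def)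
  then show "cauchy_functional (weight_int \<alpha> \<beta> \<gamma> A B t) (\<lambda>p. - weight_int \<alpha> (\<beta> - 1) \<gamma> A B t p) 1"
    using pos weight_int_pred_right
    by (intro cauchy_functional.intro cauchy_functional_axioms.intro) auto
  show "((\<lambda>s. weight_int \<alpha> \<beta> \<gamma> A B s p) has_real_derivative - \<gamma> * weight_cauchy \<alpha> \<beta> \<gamma> A B t p) (at t)" for p
    using assms t by (intro has_real_derivative_weight_int) auto
  show "weight_int \<alpha> \<beta> \<gamma> A B t (pderiv p) + \<alpha> * weight_int (\<alpha> - 1) \<beta> \<gamma> A B t p
      + \<beta> * - weight_int \<alpha> (\<beta> - 1) \<gamma> A B t p + \<gamma> * weight_cauchy \<alpha> \<beta> \<gamma> A B t p = 0" for p
    using assms t by (intro weight_int_parts) auto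
  \<comment> \<open>The general derivative rule is used with exponent \<open>\<alpha> - 1\<close>,
    which may be negative, followed by partial fractions.\<close>
  show "((\<lambda>s. weight_int (\<alpha> - 1) \<beta> \<gamma> A B s p) has_real_derivative
      - \<gamma> * (weight_cauchy \<alpha> \<beta> \<gamma> A B t p - weight_int (\<alpha> - 1) \<beta> \<gamma> A B t p) / (t - 0)) (at t)" for p
    using has_real_derivative_weight_int[of "\<alpha> - 1" \<beta> \<gamma> t A B p] weight_cauchy_pred_left[of \<alpha> \<beta> \<gamma> t A B p] assms t
    by simp
  show "((\<lambda>s. - weight_int \<alpha> (\<beta> - 1) \<gamma> A B s p) has_real_derivative
      - \<gamma> * (weight_cauchy \<alpha> \<beta> \<gamma> A B t p - - weight_int \<alpha> (\<beta> - 1) \<gamma> A B t p) / (t - 1)) (at t)" for p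
  proof -
    have "((\<lambda>s. - weight_int \<alpha> (\<beta> - 1) \<gamma> A B s p) has_real_derivative
        - (- \<gamma> * weight_cauchy \<alpha> (\<beta> - 1) \<gamma> A B t p)) (at t)"
      using assms t by (intro DERIV_minus has_real_derivative_weight_int) auto
    moreover have "- (- \<gamma> * weight_cauchy \<alpha> (\<beta> - 1) \<gamma> A B t p) = - \<gamma> * (- weight_cauchy \<alpha> (\<beta> - 1) \<gamma> A B t p)"
      by simp
    ultimately show ?thesis
      using weight_cauchy_pred_right[of \<alpha> \<beta> \<gamma> t A B p] assms t by simp
  qed
qed simp

lemma hankel_det_eq_prod_orth_norm:
  assumes "\<alpha> > 0" "\<beta> > 0" "\<gamma> > 0" "A \<ge> 0" "A + B \<ge> 0" "\<not> (A = 0 \<and> A + B = 0)"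
    and "0 < t" "t < 1"
  shows "hankel_det \<alpha> \<beta> \<gamma> A B n t = (\<Prod>k<n. orth_norm (weight_int \<alpha> \<beta> \<gamma> A B t) k)"
proof -
  interpret jacobi_deformation "weight_int \<alpha> \<beta> \<gamma> A B" "weight_cauchy \<alpha> \<beta> \<gamma> A B" \<gamma>
    "weight_int (\<alpha> - 1) \<beta> \<gamma> A B" "\<lambda>t p. - weight_int \<alpha> (\<beta> - 1) \<gamma> A B t p" \<alpha> \<beta>
    using assms by (intro jacobi_deformation_weight) auto
  have "moment \<alpha> \<beta> \<gamma> A B k t = weight_int \<alpha> \<beta> \<gamma> A B t (monom 1 k)" for k
    by (simp add: moment_def weight_int_def poly_monom)
  then show ?thesis
    using positive_functional.hankel_det_eq_prod[OF positive, of t n] assms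
    by (simp add: hankel_det_def)
qed

theorem theorem3p4:
  fixes \<alpha> \<beta> \<gamma> A B :: real and n :: nat
  assumes "\<alpha> > 0" "\<beta> > 0" "\<gamma> > 0"
    and "A \<ge> 0" "A + B \<ge> 0" "\<not> (A = 0 \<and> A + B = 0)"
    and "n \<ge> 1"
  defines "\<sigma> \<equiv> (\<lambda>t. Hn \<alpha> \<beta> \<gamma> A B n t
              + (- real n * (real n + \<alpha> + \<beta> + \<gamma>) - (\<alpha> + \<beta>)^2 / 4) * t
              + (2 * real n * (real n + \<alpha> + \<beta> + \<gamma>) + (\<alpha> + \<beta>) * \<beta> - (\<alpha> - \<beta>) * \<gamma>) / 4)"
    and "\<nu>1 \<equiv> (\<alpha> + \<beta>) / 2"
    and "\<nu>2 \<equiv> (\<beta> - \<alpha>) / 2"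
    and "\<nu>3 \<equiv> (2 * real n + \<alpha> + \<beta>) / 2"
    and "\<nu>4 \<equiv> (2 * real n + \<alpha> + \<beta> + 2 * \<gamma>) / 2"
  shows "\<forall>t\<in>{0<..<1}.
           \<sigma> differentiable (at t) \<and> deriv \<sigma> differentiable (at t) \<and>
           deriv \<sigma> t * (t * (t - 1) * deriv (deriv \<sigma>) t)^2
             + (2 * deriv \<sigma> t * (t * deriv \<sigma> t - \<sigma> t) - (deriv \<sigma> t)^2
                 - \<nu>1 * \<nu>2 * \<nu>3 * \<nu>4)^2
           = (deriv \<sigma> t + \<nu>1^2) * (deriv \<sigma> t + \<nu>2^2) * (deriv \<sigma> t + \<nu>3^2) * (deriv \<sigma> t + \<nu>4^2)"
proof
  fix t :: real assume t: "t \<in> {0<..<1}"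
  let ?L = "weight_int \<alpha> \<beta> \<gamma> A B" and ?Mt = "weight_cauchy \<alpha> \<beta> \<gamma> A B"
  interpret jacobi_deformation ?L ?Mt \<gamma>
    "weight_int (\<alpha> - 1) \<beta> \<gamma> A B" "\<lambda>t p. - weight_int \<alpha> (\<beta> - 1) \<gamma> A B t p" \<alpha> \<beta>
    using assms by (intro jacobi_deformation_weight) auto
  obtain m where n: "n = Suc m"
    using \<open>n \<ge> 1\<close> by (cases n) auto
  define N where "N = 2 * real n + \<alpha> + \<beta> + \<gamma>"
  define c1 where "c1 = - real n * (real n + \<alpha> + \<beta> + \<gamma>) - (\<alpha> + \<beta>)^2 / 4"
  define c2 where "c2 = (2 * real n * (real n + \<alpha> + \<beta> + \<gamma>) + (\<alpha> + \<beta>) * \<beta> - (\<alpha> - \<beta>) * \<gamma>) / 4"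
  define p where "p s = subleading (?L s) n" for s
  define v where "v s = off_diag \<gamma> ?Mt s m" for s
  \<comment> \<open>The formula is needed on the whole interval, since \<sigma> is to be
    differentiated twice.\<close>
  have Hn: "Hn \<alpha> \<beta> \<gamma> A B n s = - N * p s - (real n)\<^sup>2 - real n * \<alpha> + real n * \<gamma> * (s - 1)"
    if s: "s \<in> {0<..<1}" for s
  proof -
    have pos: "\<eta> u k > 0" if "u \<in> {0<..<1}" for u k
      using positive_functional.h_pos[OF positive[OF that]] .
    have "((\<lambda>u. \<Sum>k<n. ln (\<eta> u k)) has_real_derivative
        (\<Sum>k<n. 1 / \<eta> s k * (- \<gamma> * ?Mt s (\<pi> s k * \<pi> s k)))) (at s)"
      by (intro DERIV_sum DERIV_chain2[OF DERIV_ln_divide] has_real_derivative_h s pos)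
    then have "((\<lambda>u. ln (hankel_det \<alpha> \<beta> \<gamma> A B n u)) has_real_derivative
        (\<Sum>k<n. 1 / \<eta> s k * (- \<gamma> * ?Mt s (\<pi> s k * \<pi> s k)))) (at s)"
    proof (rule has_field_derivative_transform_within_open[OF _ open_S s])
      fix u :: real assume u: "u \<in> {0<..<1}"
      then have "hankel_det \<alpha> \<beta> \<gamma> A B n u = (\<Prod>k<n. \<eta> u k)"
        using assms by (intro hankel_det_eq_prod_orth_norm) auto
      then show "(\<Sum>k<n. ln (\<eta> u k)) = ln (hankel_det \<alpha> \<beta> \<gamma> A B n u)"
        using ln_prod[of "{..<n}" "\<eta> u"] pos[OF u] by (simp add: less_imp_neq[symmetric])
    qed
    then have "Hn \<alpha> \<beta> \<gamma> A B n s = s * (s - 1) * (\<Sum>k<n. 1 / \<eta> s k * (- \<gamma> * ?Mt s (\<pi> s k * \<pi> s k)))"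
      unfolding Hn_def by (simp only: DERIV_imp_deriv)
    also have "\<dots> = s * (s - 1) * (\<Sum>k<n. - \<gamma> * ?Mt s (\<pi> s k * \<pi> s k) / \<eta> s k)"
      by simp
    finally show ?thesis
      unfolding trace_formula[OF s] by (simp add: N_def p_def)
  qed
  \<comment> \<open>An explicit expression that agrees with \<open>\<sigma>\<close> on (0, 1);
    openness of the interval lets derivatives pass from one to the other.\<close>
  define \<sigma>0 where "\<sigma>0 s = - N * p s - (real n)\<^sup>2 - real n * \<alpha> + real n * \<gamma> * (s - 1) + c1 * s + c2" for s
  have \<sigma>_eq: "\<sigma>0 s = \<sigma> s" if "s \<in> {0<..<1}" for s
    using Hn[OF that] by (simp add: \<sigma>_def \<sigma>0_def c1_def c2_def)
  have d1: "(\<sigma> has_real_derivative - N * v s + real n * \<gamma> + c1) (at s)" if s: "s \<in> {0<..<1}" for s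
  proof -
    have "(p has_real_derivative v s) (at s)"
      using has_real_derivative_subleading[OF s, of m] by (simp add: p_def[abs_def] v_def n)
    then have "(\<sigma>0 has_real_derivative - N * v s + real n * \<gamma> + c1) (at s)"
      unfolding \<sigma>0_def by (auto intro!: derivative_eq_intros)
    then show ?thesis
      by (rule has_field_derivative_transform_within_open[OF _ open_S s \<sigma>_eq])
  qed
  obtain T where T: "(v has_real_derivative T / (t * (t - 1))) (at t)"
    and T2: "T\<^sup>2 = (let V0 = off_diag \<alpha> (weight_int (\<alpha> - 1) \<beta> \<gamma> A B) t m;
        V1 = off_diag \<beta> (\<lambda>t p. - weight_int \<alpha> (\<beta> - 1) \<gamma> A B t p) t m in
      (v t * (v t - \<gamma>) - V0 * (V0 - \<alpha>) - V1 * (V1 - \<beta>))\<^sup>2 - 4 * (V0 * (V0 - \<alpha>)) * (V1 * (V1 - \<beta>)))"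
    using has_real_derivative_off_diag_t[OF t, of m] unfolding v_def Let_def by blast
  have V1: "off_diag \<beta> (\<lambda>t p. - weight_int \<alpha> (\<beta> - 1) \<gamma> A B t p) t m = p t - t * v t"
    using sum_weighted_off_diag[OF t, of m] by (simp add: p_def v_def n)
  have V0: "off_diag \<alpha> (weight_int (\<alpha> - 1) \<beta> \<gamma> A B) t m = - real n - (p t - t * v t) - v t"
    using sum_off_diag[OF t, of m] V1 by (simp add: v_def n)
  have d2: "(deriv \<sigma> has_real_derivative - N * (T / (t * (t - 1)))) (at t)"
  proof (rule has_field_derivative_transform_within_open[OF _ open_S t])
    show "((\<lambda>s. - N * v s + real n * \<gamma> + c1) has_real_derivative - N * (T / (t * (t - 1)))) (at t)"
      using DERIV_add[OF DERIV_add[OF DERIV_cmult[OF T, of "- N"] DERIV_const] DERIV_const] by simp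
    show "- N * v s + real n * \<gamma> + c1 = deriv \<sigma> s" if "s \<in> {0<..<1}" for s
      using DERIV_imp_deriv[OF d1[OF that]] by simp
  qed
  have "t * (t - 1) \<noteq> 0"
    using t by auto
  then have S: "(t * (t - 1) * deriv (deriv \<sigma>) t)\<^sup>2 = N\<^sup>2 * T\<^sup>2"
    unfolding DERIV_imp_deriv[OF d2] by (simp add: power_mult_distrib)
  have "\<sigma> differentiable (at t)" "deriv \<sigma> differentiable (at t)"
    using d1[OF t] d2 real_differentiable_def by blast+
  moreover have "deriv \<sigma> t * (t * (t - 1) * deriv (deriv \<sigma>) t)^2
             + (2 * deriv \<sigma> t * (t * deriv \<sigma> t - \<sigma> t) - (deriv \<sigma> t)^2
                 - \<nu>1 * \<nu>2 * \<nu>3 * \<nu>4)^2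
           = (deriv \<sigma> t + \<nu>1^2) * (deriv \<sigma> t + \<nu>2^2) * (deriv \<sigma> t + \<nu>3^2) * (deriv \<sigma> t + \<nu>4^2)"
    unfolding S DERIV_imp_deriv[OF d1[OF t]] \<sigma>_eq[OF t, symmetric] \<sigma>0_def c1_def c2_def N_def \<nu>1_def \<nu>2_def \<nu>3_def \<nu>4_def
    by (rule sigma_form_identity) (simp add: T2 V0 V1 Let_def)
  ultimately show "\<sigma> differentiable (at t) \<and> deriv \<sigma> differentiable (at t) \<and>
           deriv \<sigma> t * (t * (t - 1) * deriv (deriv \<sigma>) t)^2
             + (2 * deriv \<sigma> t * (t * deriv \<sigma> t - \<sigma> t) - (deriv \<sigma> t)^2
                 - \<nu>1 * \<nu>2 * \<nu>3 * \<nu>4)^2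
           = (deriv \<sigma> t + \<nu>1^2) * (deriv \<sigma> t + \<nu>2^2) * (deriv \<sigma> t + \<nu>3^2) * (deriv \<sigma> t + \<nu>4^2)"
    by blast
qed

end
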